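(* Assume that $f\in L^2(\Omega)$. Let $u_H^{\varepsilon,G}\in V_H^\varepsilon$ be the solution to the Galerkin approximation $$\forall v_H^\varepsilon\in V_H^\varepsilon,\qquad a^\varepsilon(u_H^{\varepsilon,G},v_H^\varepsilon)=F(v_H^\varepsilon),$$ and let $u_H^{\varepsilon,PG}\in V_H^\varepsilon$ be the solution to the Petrov-Galerkin approximation $$\forall v_H\in V_H,\qquad a^\varepsilon(u_H^{\varepsilon,PG},v_H)=F(v_H).$$ There exists a constant $C$ independent of $\varepsilon$, $H$ and $f$ (it may depend on $\Omega$, $d$, $m$, $M$ and the regularity of the mesh) such that $$\left\|u_H^{\varepsilon,G}-u_H^{\varepsilon,PG}\right\|_{H^1(\Omega)}\le C\,H\,\|f\|_{L^2(\Omega)}.$$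
   Context: Let $\Omega\subset\mathbb{R}^d$ be a bounded domain and let $A^\varepsilon\in L^\infty(\Omega,\mathbb{R}^{d\times d})$ (not necessarily symmetric, no further structure assumed) satisfy, for some constants $M\ge m>0$ independent of $\varepsilon$: for all $\xi,\eta\in\mathbb{R}^d$, $m|\xi|^2\le \xi\cdot A^\varepsilon(x)\xi$ and $|\eta\cdot A^\varepsilon(x)\xi|\le M|\xi||\eta|$ for a.e. $x\in\Omega$. Bilinear and linear forms: $a^\varepsilon(u,v)=\int_\Omega\nabla v\cdot A^\varepsilon\nabla u$ and $F(v)=\int_\Omega f v$ on $H^1_0(\Omega)$. Mesh and $\mathbb{P}_1$ space: $\mathcal{T}_H$ is a conformal simplicial mesh of $\Omega$ (triangles if $d=2$, tetrahedra if $d=3$) of mesh size $H$ (the maximal diameter of its elements), $x_1,\dots,x_{N_v}$ are its interior vertices (those not lying on $\partial\Omega$), $V_H\subset H^1_0(\Omega)$ is the usual space of continuous functions that are affine on each $K\in\mathcal{T}_H$ and vanish on $\partial\Omega$, and $\phi_i^{\mathbb{P}_1}\in V_H$ is the unique element with $\phi_i^{\mathbb{P}_1}(x_j)=\delta_{i,j}$ for all $1\le j\le N_v$. Multiscale basis functions: $\phi_i^\varepsilon\in H^1_0(\Omega)$ is defined by: for every $K\in\mathcal{T}_H$, $-\operatorname{div}(A^\varepsilon\nabla\phi_i^\varepsilon)=0$ in $K$ (in the weak sense) and $\phi_i^\varepsilon=\phi_i^{\mathbb{P}_1}$ on $\partial K$. Set $V_H^\varepsilon=\operatorname{span}\{\phi_i^\varepsilon,\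 1\le i\le N_v\}$. Both discrete problems in the claim are well-posed. *)

theory Defs
  imports "HOL-Analysis.Analysis"
begin

section \<open>Lebesgue and Sobolev spaces\<close>

text \<open>
  Elements of \<open>L\<^sup>2(D)\<close>, \<open>H\<^sup>1(D)\<close> and \<open>H\<^sup>1\<^sub>0(D)\<close> are represented by functions on the whole space; their
  values outside \<open>D\<close>, and on null subsets of \<open>D\<close>, are irrelevant.
\<close>

definition L2 :: "(real^'d) set \<Rightarrow> (real^'d \<Rightarrow> 'b::euclidean_space) set" where
  "L2 D = {f. f \<in> borel_measurable (lebesgue_on D) \<and>
              integrable (lebesgue_on D) (\<lambda>x. (norm (f x))\<^sup>2)}"

definition L2_norm :: "(real^'d) set \<Rightarrow> (real^'d \<Rightarrow> 'b::euclidean_space) \<Rightarrow> real" where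
  "L2_norm D f = sqrt (LINT x|lebesgue_on D. (norm (f x))\<^sup>2)"

definition partial_deriv :: "'d \<Rightarrow> (real^'d \<Rightarrow> real) \<Rightarrow> real^'d \<Rightarrow> real" where
  "partial_deriv i f x = frechet_derivative f (at x) (axis i 1)"

primrec C_k :: "nat \<Rightarrow> (real^'d \<Rightarrow> real) \<Rightarrow> bool" where
  "C_k 0 f \<longleftrightarrow> continuous_on UNIV f"
| "C_k (Suc k) f \<longleftrightarrow> f differentiable_on UNIV \<and> (\<forall>i. C_k k (partial_deriv i f))"

definition test_functions :: "(real^'d) set \<Rightarrow> (real^'d \<Rightarrow> real) set" where
  "test_functions D = {\<psi>. (\<forall>k. C_k k \<psi>) \<and> compact (closure {x. \<psi> x \<noteq> 0}) \<and>
                           closure {x. \<psi> x \<noteq> 0} \<subseteq> D}"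

definition has_weak_gradient ::
    "(real^'d) set \<Rightarrow> (real^'d \<Rightarrow> real) \<Rightarrow> (real^'d \<Rightarrow> real^'d) \<Rightarrow> bool" where
  "has_weak_gradient D u g \<longleftrightarrow> u \<in> L2 D \<and> g \<in> L2 D \<and>
     (\<forall>\<psi>\<in>test_functions D. \<forall>i.
        (LINT x|lebesgue_on D. u x * partial_deriv i \<psi> x) =
        - (LINT x|lebesgue_on D. g x $ i * \<psi> x))"

definition H1 :: "(real^'d) set \<Rightarrow> (real^'d \<Rightarrow> real) set" where
  "H1 D = {u. \<exists>g. has_weak_gradient D u g}"

text \<open>For \<open>u \<in> H1 D\<close> with \<open>D\<close> open, the following is determined up to a null set.\<close>

definition weak_gradient :: "(real^'d) set \<Rightarrow> (real^'d \<Rightarrow> real) \<Rightarrow> real^'d \<Rightarrow> real^'d" where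
  "weak_gradient D u = (SOME g. has_weak_gradient D u g)"

definition H1_norm :: "(real^'d) set \<Rightarrow> (real^'d \<Rightarrow> real) \<Rightarrow> real" where
  "H1_norm D u = sqrt ((L2_norm D u)\<^sup>2 + (L2_norm D (weak_gradient D u))\<^sup>2)"

text \<open>The closure of the test functions in \<open>H\<^sup>1(D)\<close>.\<close>

definition H10 :: "(real^'d) set \<Rightarrow> (real^'d \<Rightarrow> real) set" where
  "H10 D = {u \<in> H1 D. \<exists>\<psi>. (\<forall>n. \<psi> n \<in> test_functions D) \<and>
                             (\<lambda>n. H1_norm D (\<lambda>x. u x - \<psi> n x)) \<longlonglongrightarrow> 0}"


section \<open>The continuous problem\<close>

text \<open>Essential boundedness of \<open>A\<close> is implied by the last inequality.\<close>

definition elliptic_coeff ::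
    "(real^'d) set \<Rightarrow> real \<Rightarrow> real \<Rightarrow> (real^'d \<Rightarrow> real^'d^'d) \<Rightarrow> bool" where
  "elliptic_coeff \<Omega> m M A \<longleftrightarrow> A \<in> borel_measurable (lebesgue_on \<Omega>) \<and>
     (\<forall>\<xi> \<eta>. AE x in lebesgue_on \<Omega>.
        m * (norm \<xi>)\<^sup>2 \<le> \<xi> \<bullet> (A x *v \<xi>) \<and> \<bar>\<eta> \<bullet> (A x *v \<xi>)\<bar> \<le> M * norm \<xi> * norm \<eta>)"

definition a_form ::
    "(real^'d \<Rightarrow> real^'d^'d) \<Rightarrow> (real^'d) set \<Rightarrow> (real^'d \<Rightarrow> real) \<Rightarrow> (real^'d \<Rightarrow> real) \<Rightarrow> real" where
  "a_form A D u v =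
     (LINT x|lebesgue_on D. weak_gradient D v x \<bullet> (A x *v weak_gradient D u x))"

definition F_form :: "(real^'d \<Rightarrow> real) \<Rightarrow> (real^'d) set \<Rightarrow> (real^'d \<Rightarrow> real) \<Rightarrow> real" where
  "F_form f D v = (LINT x|lebesgue_on D. f x * v x)"


section \<open>Meshes\<close>

text \<open>
  Elements are closed nondegenerate simplices, and \<^const>\<open>triangulation\<close> states that any two of them
  meet in a common (possibly empty) face. The last condition says that the mesh resolves the
  boundary, including parts of it that are not on the boundary of the closure (as in a slit domain).
\<close>

definition conformal_simplicial_mesh :: "(real^'d) set \<Rightarrow> (real^'d) set set \<Rightarrow> bool" where
  "conformal_simplicial_mesh \<Omega> \<T> \<longleftrightarrow> triangulation \<T> \<and>
     (\<forall>K\<in>\<T>. int CARD('d) simplex K) \<and> \<Union>\<T> = closure \<Omega> \<and>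
     (\<exists>\<B>. (\<forall>S\<in>\<B>. \<exists>K\<in>\<T>. S face_of K) \<and> frontier \<Omega> = \<Union>\<B>)"

definition mesh_size :: "(real^'d) set set \<Rightarrow> real" where
  "mesh_size \<T> = Max (diameter ` \<T>)"

definition inball_diameter :: "(real^'d) set \<Rightarrow> real" where
  "inball_diameter K = Sup {2 * r | r. 0 \<le> r \<and> (\<exists>c. cball c r \<subseteq> K)}"

text \<open>Regularity of the mesh in the usual sense of Ciarlet, with regularity constant \<open>\<sigma>\<close>.\<close>

definition shape_regular :: "real \<Rightarrow> (real^'d) set set \<Rightarrow> bool" where
  "shape_regular \<sigma> \<T> \<longleftrightarrow> (\<forall>K\<in>\<T>. diameter K \<le> \<sigma> * inball_diameter K)"

definition interior_vertices :: "(real^'d) set \<Rightarrow> (real^'d) set set \<Rightarrow> (real^'d) set" where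
  "interior_vertices \<Omega> \<T> = {p. (\<exists>K\<in>\<T>. p extreme_point_of K) \<and> p \<notin> frontier \<Omega>}"


section \<open>Discrete spaces\<close>

definition P1_space :: "(real^'d) set \<Rightarrow> (real^'d) set set \<Rightarrow> (real^'d \<Rightarrow> real) set" where
  "P1_space \<Omega> \<T> = {v. continuous_on (closure \<Omega>) v \<and>
     (\<forall>K\<in>\<T>. \<exists>a b. \<forall>x\<in>K. v x = a \<bullet> x + b) \<and> (\<forall>x\<in>frontier \<Omega>. v x = 0)}"

text \<open>Basis functions are indexed by the interior vertices themselves rather than by numbers.\<close>

definition P1_basis ::
    "(real^'d) set \<Rightarrow> (real^'d) set set \<Rightarrow> (real^'d \<Rightarrow> real^'d \<Rightarrow> real) \<Rightarrow> bool" where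
  "P1_basis \<Omega> \<T> \<phi> \<longleftrightarrow> (\<forall>p\<in>interior_vertices \<Omega> \<T>. \<phi> p \<in> P1_space \<Omega> \<T> \<and>
     (\<forall>q\<in>interior_vertices \<Omega> \<T>. \<phi> p q = (if p = q then 1 else 0)))"

text \<open>
  On each element \<open>K\<close>, the equation \<open>-div (A \<nabla>\<phi>\<epsilon>) = 0\<close> is imposed variationally, and equality with
  \<open>\<phi>\<close> on the boundary of \<open>K\<close> means that the difference lies in \<open>H\<^sup>1\<^sub>0(K)\<close>.
\<close>

definition multiscale_basis ::
    "(real^'d \<Rightarrow> real^'d^'d) \<Rightarrow> (real^'d) set \<Rightarrow> (real^'d) set set \<Rightarrow>
     (real^'d \<Rightarrow> real^'d \<Rightarrow> real) \<Rightarrow> (real^'d \<Rightarrow> real^'d \<Rightarrow> real) \<Rightarrow> bool" where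
  "multiscale_basis A \<Omega> \<T> \<phi> \<phi>\<epsilon> \<longleftrightarrow> (\<forall>p\<in>interior_vertices \<Omega> \<T>. \<phi>\<epsilon> p \<in> H10 \<Omega> \<and>
     (\<forall>K\<in>\<T>. (\<forall>w\<in>H10 (interior K). a_form A (interior K) (\<phi>\<epsilon> p) w = 0) \<and>
             (\<lambda>x. \<phi>\<epsilon> p x - \<phi> p x) \<in> H10 (interior K)))"

definition multiscale_space ::
    "(real^'d) set \<Rightarrow> (real^'d) set set \<Rightarrow> (real^'d \<Rightarrow> real^'d \<Rightarrow> real) \<Rightarrow> (real^'d \<Rightarrow> real) set" where
  "multiscale_space \<Omega> \<T> \<phi>\<epsilon> =
     {(\<lambda>x. \<Sum>p\<in>interior_vertices \<Omega> \<T>. c p * \<phi>\<epsilon> p x) | c. True}"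

definition discrete_solution ::
    "(real^'d \<Rightarrow> real^'d^'d) \<Rightarrow> (real^'d \<Rightarrow> real) \<Rightarrow> (real^'d) set \<Rightarrow>
     (real^'d \<Rightarrow> real) set \<Rightarrow> (real^'d \<Rightarrow> real) set \<Rightarrow> (real^'d \<Rightarrow> real) \<Rightarrow> bool" where
  "discrete_solution A f \<Omega> Trial Test u \<longleftrightarrow>
     u \<in> Trial \<and> (\<forall>v\<in>Test. a_form A \<Omega> u v = F_form f \<Omega> v)"

end

theory Submission
  imports Defs "HOL-Real_Asymp.Real_Asymp" "HOL-Computational_Algebra.Polynomial"
begin

text \<open>Let \<open>e = uG - uPG\<close>, which is a combination of the multiscale basis functions, and let \<open>e\<^sub>1\<close> be the
  combination of the \<open>P\<^sub>1\<close> basis functions with the same coefficients. The remainder \<open>w = e - e\<^sub>1\<close> lies in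
  \<open>H\<^sup>1\<^sub>0(K)\<close> for every element \<open>K\<close>. The estimate then follows in three steps.

  \<^item> \<^emph>\<open>Error identity.\<close> Testing the Galerkin problem with \<open>e\<close> and the Petrov-Galerkin problem with
    \<open>e\<^sub>1\<close>, and using that \<open>uPG\<close> solves the homogeneous equation in every element, so that
    \<open>a(uPG, w) = 0\<close>, one finds \<open>a(e, e) = F(e) - F(e\<^sub>1) = F(w)\<close>. Hence
    \<open>m \<parallel>\<nabla>e\<parallel>\<^sup>2 \<le> \<parallel>f\<parallel> \<parallel>w\<parallel>\<close>.

  \<^item> \<^emph>\<open>Local orthogonality.\<close> On \<open>K\<close> the gradient of \<open>e\<^sub>1\<close> is constant and the mean of \<open>\<nabla>w\<close> is zero, so
    \<open>\<nabla>e = \<nabla>e\<^sub>1 + \<nabla>w\<close> is an orthogonal decomposition and \<open>\<parallel>\<nabla>w\<parallel> \<le> \<parallel>\<nabla>e\<parallel>\<close> on \<open>K\<close>. With the Poincare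
    inequality on \<open>K\<close> this gives \<open>\<parallel>w\<parallel> \<le> 2 H \<parallel>\<nabla>e\<parallel>\<close> (lemmas \<open>remainder_bound_piece\<close> and
    \<open>remainder_bound\<close>).

  \<^item> \<^emph>\<open>Conclusion.\<close> Together these yield \<open>m \<parallel>\<nabla>e\<parallel> \<le> 2 H \<parallel>f\<parallel>\<close> (lemma \<open>Galerkin_Petrov_Galerkin_gradient_bound\<close>),
    and the Poincare inequality on \<open>\<Omega>\<close> controls \<open>\<parallel>e\<parallel>\<close> by \<open>\<parallel>\<nabla>e\<parallel>\<close>.

  Weak gradients are chosen arbitrarily among the admissible ones, so every computation with them rests
  on their uniqueness almost everywhere, that is, on the fundamental lemma of the calculus of variations
  (lemma \<open>AE_eq_0_if_test_integrals_eq_0\<close>), for which smooth bump functions are constructed.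
  The other analytic input is integration by parts, obtained from the translation invariance of
  Lebesgue measure. It is passed to limits of test functions: Green's formula for \<open>H\<^sup>1\<^sub>0\<close> (lemma
  \<open>H10_Green\<close>) and the Poincare inequality (lemma \<open>Poincare\<close>).

  That piecewise affine functions are weakly differentiable across the faces of the mesh is never
  checked on simplices: \<open>w\<close> is weakly differentiable on \<open>\<Omega>\<close> since it is glued from functions with zero
  boundary values (lemma \<open>weak_gradient_glue\<close>), and therefore so is \<open>e\<^sub>1 = e - w\<close>.\<close>

section \<open>Functions with continuous derivatives\<close>

definition grad :: "(real^'d \<Rightarrow> real) \<Rightarrow> real^'d \<Rightarrow> real^'d" where
  "grad f x = (\<chi> i. partial_deriv i f x)"

lemma partial_deriv_eq:
  "(f has_derivative f') (at x) \<Longrightarrow> partial_deriv i f x = f' (axis i 1)"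
  unfolding partial_deriv_def by (metis frechet_derivative_at)

lemma differentiable_has_frechet:
  "f differentiable_on UNIV \<Longrightarrow> (f has_derivative frechet_derivative f (at x)) (at x)"
  by (simp add: differentiable_on_def frechet_derivative_works[symmetric])

lemma partial_deriv_add:
  assumes "f differentiable_on UNIV" "g differentiable_on UNIV"
  shows "partial_deriv i (\<lambda>x. f x + g x) = (\<lambda>x. partial_deriv i f x + partial_deriv i g x)"
proof
  fix x
  show "partial_deriv i (\<lambda>x. f x + g x) x = partial_deriv i f x + partial_deriv i g x"
    using partial_deriv_eq[OF has_derivative_add[OF differentiable_has_frechet[OF assms(1)]
        differentiable_has_frechet[OF assms(2)]], of i x]
    by (simp add: partial_deriv_def)
qed

lemma partial_deriv_mult:
  fixes f g :: "real^'d \<Rightarrow> real"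
  assumes "f differentiable_on UNIV" "g differentiable_on UNIV"
  shows "partial_deriv i (\<lambda>x. f x * g x) =
    (\<lambda>x. f x * partial_deriv i g x + partial_deriv i f x * g x)"
proof
  fix x
  show "partial_deriv i (\<lambda>x. f x * g x) x = f x * partial_deriv i g x + partial_deriv i f x * g x"
    using partial_deriv_eq[OF has_derivative_mult[OF differentiable_has_frechet[OF assms(1)]
        differentiable_has_frechet[OF assms(2)]], of i x]
    by (simp add: partial_deriv_def)
qed

lemma partial_deriv_const:
  shows "partial_deriv i (\<lambda>x. c) = (\<lambda>x. 0)"
proof
  fix x show "partial_deriv i (\<lambda>x. c) x = 0"
    using partial_deriv_eq[OF has_derivative_const[of c "at x"], of i] by simp
qed

lemma partial_deriv_affine:
  fixes a :: "real^'d"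
  shows "partial_deriv i (\<lambda>x. a \<bullet> x + b) = (\<lambda>x. a $ i)"
proof
  fix x
  have "((\<lambda>x. a \<bullet> x + b) has_derivative (\<lambda>h. a \<bullet> h)) (at x)"
    by (auto intro!: derivative_eq_intros)
  from partial_deriv_eq[OF this] show "partial_deriv i (\<lambda>x. a \<bullet> x + b) x = a $ i"
    by (simp add: inner_axis)
qed

lemma C_k_Suc_imp: "C_k (Suc k) f \<Longrightarrow> C_k k f"
proof (induction k arbitrary: f)
  case 0
  then show ?case by (simp add: differentiable_imp_continuous_on)
next
  case (Suc k)
  from Suc.prems have "f differentiable_on UNIV" and "C_k (Suc k) (partial_deriv i f)" for i
    using C_k.simps(2)[of "Suc k" f] by blast+
  moreover from this(2) have "C_k k (partial_deriv i f)" for i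
    by (rule Suc.IH)
  ultimately show ?case
    unfolding C_k.simps by blast
qed

lemma C_k_const: "C_k k (\<lambda>x. c)"
  by (induction k arbitrary: c) (simp_all add: partial_deriv_const)

lemma C_k_add: "C_k k f \<Longrightarrow> C_k k g \<Longrightarrow> C_k k (\<lambda>x. f x + g x)"
proof (induction k arbitrary: f g)
  case 0
  then show ?case by (simp add: continuous_on_add)
next
  case (Suc k)
  then have d: "f differentiable_on UNIV" "g differentiable_on UNIV"
    and p: "C_k k (partial_deriv i f)" "C_k k (partial_deriv i g)" for i
    by auto
  have "C_k k (partial_deriv i (\<lambda>x. f x + g x))" for i
    unfolding partial_deriv_add[OF d] by (intro Suc.IH p)
  moreover have "(\<lambda>x. f x + g x) differentiable_on UNIV"
    using d by (rule differentiable_on_add)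
  ultimately show ?case
    unfolding C_k.simps by blast
qed

lemma C_k_mult:
  fixes f g :: "real^'d \<Rightarrow> real"
  shows "C_k k f \<Longrightarrow> C_k k g \<Longrightarrow> C_k k (\<lambda>x. f x * g x)"
proof (induction k arbitrary: f g)
  case 0
  then show ?case by (simp add: continuous_on_mult)
next
  case (Suc k)
  then have d: "f differentiable_on UNIV" "g differentiable_on UNIV"
    and p: "C_k k (partial_deriv i f)" "C_k k (partial_deriv i g)" for i
    by auto
  have "C_k k (partial_deriv i (\<lambda>x. f x * g x))" for i
    unfolding partial_deriv_mult[OF d]
    by (intro C_k_add Suc.IH p C_k_Suc_imp[OF Suc.prems(1)] C_k_Suc_imp[OF Suc.prems(2)])
  moreover have "(\<lambda>x. f x * g x) differentiable_on UNIV"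
    using d by (rule differentiable_on_mult)
  ultimately show ?case
    unfolding C_k.simps by blast
qed

lemma C_k_prod:
  fixes f :: "'i \<Rightarrow> real^'d \<Rightarrow> real"
  shows "(\<And>i. i \<in> I \<Longrightarrow> C_k k (f i)) \<Longrightarrow> C_k k (\<lambda>x. \<Prod>i\<in>I. f i x)"
  by (induction I rule: infinite_finite_induct) (simp_all add: C_k_const C_k_mult)

text \<open>A smooth function of one variable enters together with the sequence of its derivatives, because each
  differentiation in the \<open>i\<close>-th direction passes from \<open>h j\<close> to \<open>h (Suc j)\<close>.\<close>

lemma C_k_coordinate:
  fixes h :: "nat \<Rightarrow> real \<Rightarrow> real"
  assumes h: "\<And>j t. (h j has_real_derivative h (Suc j) t) (at t)"
  shows "C_k k (\<lambda>x::real^'d. h j (\<alpha> * x $ i + \<beta>))"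
proof (induction k arbitrary: j)
  have D: "((\<lambda>x::real^'d. h j (\<alpha> * x $ i + \<beta>)) has_derivative
      (\<lambda>v. h (Suc j) (\<alpha> * x $ i + \<beta>) * (\<alpha> * v $ i))) (at x)" for j x
  proof -
    have 1: "((\<lambda>x::real^'d. \<alpha> * x $ i + \<beta>) has_derivative (\<lambda>v. \<alpha> * v $ i)) (at x)"
      by (auto intro!: derivative_eq_intros bounded_linear.has_derivative[OF bounded_linear_vec_nth])
    have 2: "(h j has_derivative (*) (h (Suc j) (\<alpha> * x $ i + \<beta>))) (at (\<alpha> * x $ i + \<beta>))"
      using h unfolding has_field_derivative_def .
    show ?thesis using has_derivative_compose[OF 1 2] .
  qed
  {
    case 0
    have "isCont (\<lambda>x::real^'d. h j (\<alpha> * x $ i + \<beta>)) x" for x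
      using D by (rule has_derivative_continuous)
    then show ?case by (simp add: continuous_on_eq_continuous_at)
  next
    case (Suc k)
    have p: "partial_deriv l (\<lambda>x. h j (\<alpha> * x $ i + \<beta>)) =
        (\<lambda>x. (if l = i then \<alpha> else 0) * h (Suc j) (\<alpha> * x $ i + \<beta>))" for l
    proof
      fix x :: "real^'d"
      show "partial_deriv l (\<lambda>x. h j (\<alpha> * x $ i + \<beta>)) x =
          (if l = i then \<alpha> else 0) * h (Suc j) (\<alpha> * x $ i + \<beta>)"
        by (subst partial_deriv_eq[OF D]) (simp add: axis_def)
    qed
    have "C_k k (partial_deriv l (\<lambda>x::real^'d. h j (\<alpha> * x $ i + \<beta>)))" for l
      unfolding p by (rule C_k_mult[OF C_k_const Suc])
    moreover have "(\<lambda>x::real^'d. h j (\<alpha> * x $ i + \<beta>)) differentiable_on UNIV"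
      using D unfolding differentiable_on_def differentiable_def by blast
    ultimately show ?case
      unfolding C_k.simps by blast
  }
qed

section \<open>Bump functions\<close>

text \<open>For \<open>p = 1\<close> this is the classical function \<open>exp (-1/t)\<close>, extended by zero to \<open>t \<le> 0\<close>. The polynomial
  factor makes the family closed under differentiation, so that all of its members are smooth.\<close>

definition flat :: "real poly \<Rightarrow> real \<Rightarrow> real" where
  "flat p t = (if 0 < t then poly p (1 / t) * exp (- (1 / t)) else 0)"

lemma poly_times_exp_tendsto_0:
  fixes p :: "real poly"
  shows "((\<lambda>s. poly p s * exp (- s)) \<longlongrightarrow> 0) at_top"
proof -
  have "((\<lambda>s. \<Sum>k\<le>degree p. coeff p k * (s ^ k / exp s)) \<longlongrightarrow> (\<Sum>k\<le>degree p. coeff p k * 0)) at_top"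
    by (intro tendsto_sum tendsto_mult tendsto_const tendsto_power_div_exp_0)
  moreover have "(\<Sum>k\<le>degree p. coeff p k * (s ^ k / exp s)) = poly p s * exp (- s)" for s
    by (simp add: poly_altdef sum_distrib_right exp_minus divide_inverse mult.assoc)
  ultimately show ?thesis by simp
qed

lemma flat_has_derivative:
  "(flat p has_real_derivative flat ([:0, 0, 1:] * (p - pderiv p)) t) (at t)"
proof -
  consider "t > 0" | "t < 0" | "t = 0" by linarith
  then show ?thesis
  proof cases
    case 1
    have "((\<lambda>t. poly p (1 / t) * exp (- (1 / t))) has_real_derivative
        flat ([:0, 0, 1:] * (p - pderiv p)) t) (at t)"
      using 1 by (auto intro!: derivative_eq_intros simp: flat_def field_simps)
    then show ?thesis
      by (rule has_field_derivative_transform_within_open[of _ _ _ "{0<..}"])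
         (use 1 in \<open>auto simp: flat_def\<close>)
  next
    case 2
    have "((\<lambda>t. 0) has_real_derivative 0) (at t)" by simp
    then have "(flat p has_real_derivative 0) (at t)"
      by (rule has_field_derivative_transform_within_open[of _ _ _ "{..<0}"])
         (use 2 in \<open>auto simp: flat_def\<close>)
    then show ?thesis using 2 by (simp add: flat_def)
  next
    case 3
    have "((\<lambda>t. poly ([:0, 1:] * p) (inverse t) * exp (- inverse t)) \<longlongrightarrow> 0) (at_right 0)"
      by (rule filterlim_compose[OF poly_times_exp_tendsto_0 filterlim_inverse_at_top_right])
    then have "((\<lambda>t. flat p t / t) \<longlongrightarrow> 0) (at_right 0)"
      by (rule Lim_transform_eventually)
         (auto simp: eventually_at_right_field flat_def field_simps intro!: exI[of _ 1])
    moreover have "((\<lambda>t. flat p t / t) \<longlongrightarrow> 0) (at_left 0)"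
      by (rule Lim_transform_eventually[OF tendsto_const])
         (auto simp: eventually_at_left_field flat_def intro!: exI[of _ "-1"])
    ultimately have "((\<lambda>t. flat p t / t) \<longlongrightarrow> 0) (at 0)"
      by (simp add: filterlim_split_at)
    then show ?thesis
      using 3 by (simp add: has_field_derivative_iff flat_def)
  qed
qed

text \<open>Dilating by \<open>n\<close> steepens the flanks without enlarging the support, the box from \<open>a\<close> to \<open>b\<close>.\<close>

definition bump :: "nat \<Rightarrow> real^'d \<Rightarrow> real^'d \<Rightarrow> real^'d \<Rightarrow> real" where
  "bump n a b x = (\<Prod>i\<in>UNIV. flat 1 (n * x $ i + - (n * a $ i)) * flat 1 (- n * x $ i + n * b $ i))"

lemma C_k_bump: "C_k k (bump n a b)"
proof -
  \<comment> \<open>The iterated derivatives of \<open>flat 1\<close>.\<close>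
  define h where "h j = flat (((\<lambda>p. [:0, 0, 1:] * (p - pderiv p)) ^^ j) 1)" for j
  have h: "(h j has_real_derivative h (Suc j) t) (at t)" for j t
    using flat_has_derivative by (simp add: h_def)
  have h0: "flat 1 = h 0" by (simp add: h_def)
  show ?thesis
    unfolding bump_def[abs_def] h0
    by (rule C_k_prod, rule C_k_mult) (rule C_k_coordinate[where h = h, OF h])+
qed

lemma flat_bounds: "0 \<le> flat 1 t" "flat 1 t \<le> 1"
  by (auto simp: flat_def)

lemma bump_bounds: "0 \<le> bump n a b x" "bump n a b x \<le> 1"
  unfolding bump_def by (auto intro!: prod_nonneg prod_le_1 mult_le_one simp: flat_bounds)

lemma bump_outside:
  assumes "x \<notin> box a b" shows "bump n a b x = 0"
proof -
  obtain i where "x $ i \<le> a $ i \<or> b $ i \<le> x $ i"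
    using assms by (auto simp: mem_box_cart not_less)
  then have "n * x $ i + - (n * a $ i) \<le> 0 \<or> - n * x $ i + n * b $ i \<le> 0"
    by (auto simp: mult_left_mono)
  then have "flat 1 (n * x $ i + - (n * a $ i)) * flat 1 (- n * x $ i + n * b $ i) = 0"
    by (auto simp: flat_def)
  then show ?thesis
    unfolding bump_def by (intro prod_zero) auto
qed

lemma bump_tendsto_indicator: "(\<lambda>n. bump n a b x) \<longlonglongrightarrow> indicator (box a b) x"
proof (cases "x \<in> box a b")
  case True
  have *: "(\<lambda>n. flat 1 (real n * s)) \<longlonglongrightarrow> 1" if "s > 0" for s
  proof -
    have "(\<lambda>n. exp (- (1 / (real n * s)))) \<longlonglongrightarrow> exp (- 0)"
      using that by (intro tendsto_intros) real_asymp
    then have "(\<lambda>n. exp (- (1 / (real n * s)))) \<longlonglongrightarrow> 1" by simp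
    then show ?thesis
      by (rule Lim_transform_eventually)
         (use that in \<open>auto simp: flat_def eventually_sequentially intro!: exI[of _ 1]\<close>)
  qed
  have "(\<lambda>n. flat 1 (real n * x $ i + - (real n * a $ i)) * flat 1 (- real n * x $ i + real n * b $ i)) \<longlonglongrightarrow> 1 * 1" for i
    using tendsto_mult[OF *[of "x $ i - a $ i"] *[of "b $ i - x $ i"]] True
    by (simp add: algebra_simps mem_box_cart)
  then have "(\<lambda>n. bump n a b x) \<longlonglongrightarrow> (\<Prod>i\<in>(UNIV::'a set). 1 * 1)"
    unfolding bump_def by (intro tendsto_prod) auto
  with True show ?thesis by simp
qed (simp add: bump_outside)

text \<open>The support enters the proofs only through some compact subset of \<open>D\<close> outside of which the function
  vanishes.\<close>

lemma test_functionsI: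
  assumes "\<And>k. C_k k \<psi>" "compact S" "S \<subseteq> D" "\<And>x. x \<notin> S \<Longrightarrow> \<psi> x = 0"
  shows "\<psi> \<in> test_functions D"
proof -
  have "{x. \<psi> x \<noteq> 0} \<subseteq> S"
    using assms(4) by blast
  then have "closure {x. \<psi> x \<noteq> 0} \<subseteq> S"
    by (rule closure_minimal) (rule compact_imp_closed[OF assms(2)])
  moreover from this have "compact (closure {x. \<psi> x \<noteq> 0})"
    using compact_Int_closed[OF assms(2) closed_closure[of "{x. \<psi> x \<noteq> 0}"]] by (simp add: Int_absorb1)
  ultimately show ?thesis
    using assms(1,3) unfolding test_functions_def by blast
qed

lemma test_functionsD:
  assumes "\<psi> \<in> test_functions D"
  obtains S where "\<And>k. C_k k \<psi>" "compact S" "S \<subseteq> D" "\<And>x. x \<notin> S \<Longrightarrow> \<psi> x = 0"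
proof
  show "C_k k \<psi>" for k using assms by (simp add: test_functions_def)
  show "compact (closure {x. \<psi> x \<noteq> 0})" "closure {x. \<psi> x \<noteq> 0} \<subseteq> D"
    using assms by (simp_all add: test_functions_def)
  show "\<psi> x = 0" if "x \<notin> closure {x. \<psi> x \<noteq> 0}" for x
    using that closure_subset[of "{x. \<psi> x \<noteq> 0}"] by blast
qed

lemma bump_test_function: "cbox a b \<subseteq> D \<Longrightarrow> bump n a b \<in> test_functions D"
  by (rule test_functionsI[of _ "cbox a b"]) (auto simp: C_k_bump intro: bump_outside dest: subsetD[OF box_subset_cbox])

lemma test_functions_mono: "D \<subseteq> E \<Longrightarrow> test_functions D \<subseteq> test_functions E"
  by (auto simp: test_functions_def)

lemma test_functions_add:
  assumes "\<psi> \<in> test_functions D" "\<eta> \<in> test_functions D"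
  shows "(\<lambda>x. \<psi> x + \<eta> x) \<in> test_functions D"
proof -
  from assms(1) obtain S where S: "\<And>k. C_k k \<psi>" "compact S" "S \<subseteq> D" "\<And>x. x \<notin> S \<Longrightarrow> \<psi> x = 0"
    by (rule test_functionsD) blast
  from assms(2) obtain T where T: "\<And>k. C_k k \<eta>" "compact T" "T \<subseteq> D" "\<And>x. x \<notin> T \<Longrightarrow> \<eta> x = 0"
    by (rule test_functionsD) blast
  show ?thesis
  proof (rule test_functionsI)
    show "C_k k (\<lambda>x. \<psi> x + \<eta> x)" for k by (rule C_k_add[OF S(1) T(1)])
    show "compact (S \<union> T)" using S(2) T(2) by (rule compact_Un)
  qed (use S T in auto)
qed

lemma test_functions_cmult:
  assumes "\<psi> \<in> test_functions D"
  shows "(\<lambda>x. c * \<psi> x) \<in> test_functions D"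
proof -
  from assms obtain S where S: "\<And>k. C_k k \<psi>" "compact S" "S \<subseteq> D" "\<And>x. x \<notin> S \<Longrightarrow> \<psi> x = 0"
    by (rule test_functionsD) blast
  show ?thesis
  proof (rule test_functionsI)
    show "C_k k (\<lambda>x. c * \<psi> x)" for k by (rule C_k_mult[OF C_k_const S(1)])
  qed (use S in auto)
qed

section \<open>Integration by parts\<close>

text \<open>This is \<open>C_k 1\<close> with its recursion unfolded.\<close>

definition C1 :: "(real^'d \<Rightarrow> real) \<Rightarrow> bool" where
  "C1 f \<longleftrightarrow> f differentiable_on UNIV \<and> (\<forall>i. continuous_on UNIV (partial_deriv i f))"

lemma C1_continuous: "C1 f \<Longrightarrow> continuous_on S f"
  unfolding C1_def by (meson continuous_on_subset differentiable_imp_continuous_on subset_UNIV)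

lemma C1_continuous_partial: "C1 f \<Longrightarrow> continuous_on S (partial_deriv i f)"
  unfolding C1_def by (meson continuous_on_subset subset_UNIV)

lemma C1_mult:
  assumes "C1 f" "C1 g" shows "C1 (\<lambda>x. f x * g x)"
proof -
  have "f differentiable_on UNIV" "g differentiable_on UNIV"
    using assms by (auto simp: C1_def)
  then show ?thesis
    unfolding C1_def
    by (simp add: partial_deriv_mult differentiable_on_mult)
       (intro allI continuous_on_add continuous_on_mult C1_continuous[OF assms(1)]
         C1_continuous[OF assms(2)] C1_continuous_partial[OF assms(1)] C1_continuous_partial[OF assms(2)])
qed

lemma C1_affine: "C1 (\<lambda>x::real^'d. a \<bullet> x + b)"
  unfolding C1_def partial_deriv_affine differentiable_on_def
  by (auto simp: differentiable_def intro!: exI derivative_eq_intros)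

lemma C1_if_C_k: "(\<And>k. C_k k f) \<Longrightarrow> C1 f"
proof -
  assume "\<And>k. C_k k f"
  from this[of "Suc 0"] show "C1 f" by (simp add: C1_def)
qed

lemma partial_deriv_line:
  assumes "C1 f"
  shows "((\<lambda>t. f (x + t *\<^sub>R axis i 1)) has_real_derivative partial_deriv i f (x + t *\<^sub>R axis i 1)) (at t)"
proof -
  have 1: "((\<lambda>t. x + t *\<^sub>R axis i 1) has_derivative (\<lambda>h. h *\<^sub>R axis i (1::real))) (at t)"
    by (auto intro!: derivative_eq_intros)
  have 2: "(f has_derivative frechet_derivative f (at (x + t *\<^sub>R axis i 1))) (at (x + t *\<^sub>R axis i 1))"
    using assms by (auto simp: C1_def intro: differentiable_has_frechet)
  have "linear (frechet_derivative f (at (x + t *\<^sub>R axis i 1)))"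
    using 2 by (rule has_derivative_linear)
  then have "frechet_derivative f (at (x + t *\<^sub>R axis i 1)) (h *\<^sub>R axis i 1) =
      partial_deriv i f (x + t *\<^sub>R axis i 1) * h" for h
    by (simp add: linear_cmul partial_deriv_def)
  then show ?thesis
    using has_derivative_compose[OF 1 2]
    by (simp add: has_field_derivative_def mult.commute[of _ "partial_deriv i f _"])
qed

lemma partial_deriv_outside:
  assumes "closed S" "\<And>x. x \<notin> S \<Longrightarrow> f x = 0" "x \<notin> S"
  shows "partial_deriv i f x = 0"
proof -
  have "((\<lambda>x. 0) has_derivative (\<lambda>h. 0)) (at x)" by simp
  then have "(f has_derivative (\<lambda>h. 0)) (at x)"
    by (rule has_derivative_transform_within_open[of _ _ _ _ "- S"]) (use assms in auto)
  from partial_deriv_eq[OF this] show ?thesis by simp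
qed

lemma integrable_lebesgue_compact_support:
  fixes f :: "real^'d \<Rightarrow> real"
  assumes "continuous_on UNIV f" "compact S" "\<And>x. x \<notin> S \<Longrightarrow> f x = 0"
  shows "integrable lebesgue f"
proof -
  have "integrable lborel (\<lambda>x. indicator S x *\<^sub>R f x)"
    using assms by (intro borel_integrable_compact) (auto intro: continuous_on_subset)
  moreover have "(\<lambda>x. indicator S x *\<^sub>R f x) = f"
    using assms by (auto simp: indicator_def fun_eq_iff)
  ultimately show ?thesis
    by (simp add: integrable_completion)
qed

text \<open>The integral of a difference quotient vanishes by translation invariance, so its limit, the
  integral of the derivative, vanishes too; no iterated integration is involved.\<close>

lemma integral_partial_deriv_0:
  fixes f :: "real^'d \<Rightarrow> real"
  assumes "C1 f" "compact S" "\<And>x. x \<notin> S \<Longrightarrow> f x = 0"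
  shows "(LINT x|lebesgue. partial_deriv i f x) = 0"
proof -
  let ?e = "axis i 1 :: real^'d"
  \<comment> \<open>Difference quotients with step \<open>1 / (n + 1)\<close>, which is at most \<open>1\<close>: this confines their supports to one ball.\<close>
  define q where "q n x = real (Suc n) * (f (x + (1 / real (Suc n)) *\<^sub>R ?e) - f x)" for n x
  have cf: "continuous_on UNIV f" and cd: "continuous_on UNIV (partial_deriv i f)"
    using assms(1) by (auto intro: C1_continuous C1_continuous_partial)
  have mf[measurable]: "f \<in> borel_measurable borel"
    and md[measurable]: "partial_deriv i f \<in> borel_measurable borel"
    using cf cd by (auto intro: borel_measurable_continuous_onI)
  obtain R where R: "S \<subseteq> cball 0 R"
    using compact_imp_bounded[OF assms(2)] by (auto simp: bounded_iff subset_eq)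
  have "bounded (partial_deriv i f ` cball 0 (R + 2))"
    using cd by (intro compact_imp_bounded compact_continuous_image) (auto intro: continuous_on_subset)
  then obtain B where "\<forall>y\<in>partial_deriv i f ` cball 0 (R + 2). norm y \<le> B"
    unfolding bounded_iff by blast
  then have B: "\<bar>partial_deriv i f x\<bar> \<le> B" if "x \<in> cball 0 (R + 2)" for x
    using that by (metis imageI real_norm_def)
  have intf: "integrable lborel f"
    using integrable_lebesgue_compact_support[OF cf assms(2,3)] by (simp add: integrable_completion)
  have 0: "integral\<^sup>L lborel (q n) = 0" for n
  proof -
    let ?v = "(1 / real (Suc n)) *\<^sub>R ?e"
    have "integral\<^sup>L lborel f = integral\<^sup>L (distr lborel borel ((+) ?v)) f"
      by (simp add: lborel_distr_plus)
    also have "\<dots> = (LINT x|lborel. f (x + ?v))"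
      by (subst integral_distr) (simp_all add: add.commute)
    finally have eq: "integral\<^sup>L lborel f = (LINT x|lborel. f (x + ?v))" .
    have "integrable (distr lborel borel ((+) ?v)) f"
      using intf by (simp add: lborel_distr_plus)
    then have "integrable lborel (\<lambda>x. f (x + ?v))"
      by (subst (asm) integrable_distr_eq) (simp_all add: add.commute)
    then show ?thesis
      using eq intf by (simp add: q_def[abs_def] del: of_nat_Suc)
  qed
  have "(\<lambda>n. integral\<^sup>L lborel (q n)) \<longlonglongrightarrow> integral\<^sup>L lborel (partial_deriv i f)"
  proof (rule integral_dominated_convergence)
    show "partial_deriv i f \<in> borel_measurable lborel" by simp
    show "q n \<in> borel_measurable lborel" for n unfolding q_def by simp
    show "integrable lborel (\<lambda>x. indicator (cball 0 (R + 1)) x *\<^sub>R B)"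
      by (intro borel_integrable_compact) auto
    show "AE x in lborel. (\<lambda>n. q n x) \<longlonglongrightarrow> partial_deriv i f x"
    proof (rule AE_I2)
      fix x
      have "((\<lambda>t. (f (x + t *\<^sub>R ?e) - f x) / t) \<longlongrightarrow> partial_deriv i f x) (at 0)"
        using partial_deriv_line[OF assms(1), of x i 0] by (simp add: has_field_derivative_iff)
      moreover have "filterlim (\<lambda>n. 1 / real (Suc n)) (at 0) sequentially"
        by (rule filterlim_atI, rule LIMSEQ_Suc, rule lim_1_over_n) simp
      ultimately have "(\<lambda>n. (f (x + (1 / real (Suc n)) *\<^sub>R ?e) - f x) / (1 / real (Suc n))) \<longlonglongrightarrow> partial_deriv i f x"
        by (rule filterlim_compose)
      then show "(\<lambda>n. q n x) \<longlonglongrightarrow> partial_deriv i f x"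
        by (simp add: q_def mult.commute)
    qed
    show "AE x in lborel. norm (q n x) \<le> indicator (cball 0 (R + 1)) x *\<^sub>R B" for n
    proof (rule AE_I2)
      fix x
      let ?h = "1 / real (Suc n)"
      have h: "0 < ?h" "?h \<le> 1" by auto
      have norm_le: "norm (x + t *\<^sub>R ?e) \<le> norm x + \<bar>t\<bar>" "norm x \<le> norm (x + t *\<^sub>R ?e) + \<bar>t\<bar>" for t
        using norm_triangle_ineq[of x "t *\<^sub>R ?e"] norm_triangle_ineq4[of "x + t *\<^sub>R ?e" "t *\<^sub>R ?e"] by auto
      show "norm (q n x) \<le> indicator (cball 0 (R + 1)) x *\<^sub>R B"
      proof (cases "x \<in> cball 0 (R + 1)")
        case True
        obtain z where z: "0 < z" "z < ?h"
          "f (x + ?h *\<^sub>R ?e) - f (x + 0 *\<^sub>R ?e) = (?h - 0) * partial_deriv i f (x + z *\<^sub>R ?e)"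
          using MVT2[OF h(1), of "\<lambda>t. f (x + t *\<^sub>R ?e)" "\<lambda>t. partial_deriv i f (x + t *\<^sub>R ?e)"]
            partial_deriv_line[OF assms(1), of x i] by auto
        have "q n x = partial_deriv i f (x + z *\<^sub>R ?e)"
          using z(3) by (simp add: q_def)
        moreover have "z < 1" using z(2) h(2) by (rule less_le_trans)
        then have "x + z *\<^sub>R ?e \<in> cball 0 (R + 2)"
          using True z(1) norm_le(1)[of z] by auto
        ultimately show ?thesis using True B by simp
      next
        case False
        then have "norm x > R + 1" by simp
        moreover have "norm x \<le> norm (x + ?h *\<^sub>R ?e) + ?h"
          using norm_le(2)[of ?h] h(1) by (simp only: abs_of_pos)
        ultimately have "norm (x + ?h *\<^sub>R ?e) > R" "norm x > R"
          using h(2) by linarith+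
        then have "x + ?h *\<^sub>R ?e \<notin> S" "x \<notin> S" using R by auto
        then show ?thesis using False assms(3) by (simp add: q_def)
      qed
    qed
  qed
  then have "integral\<^sup>L lborel (partial_deriv i f) = 0"
    by (simp add: 0 LIMSEQ_const_iff)
  then show ?thesis
    by (simp add: integral_completion)
qed

lemma integration_by_parts:
  fixes \<psi> \<eta> :: "real^'d \<Rightarrow> real"
  assumes "C1 \<psi>" "C1 \<eta>" "compact S" "\<And>x. x \<notin> S \<Longrightarrow> \<psi> x = 0"
  shows "(LINT x|lebesgue. \<psi> x * partial_deriv i \<eta> x) = - (LINT x|lebesgue. partial_deriv i \<psi> x * \<eta> x)"
proof -
  have d: "\<psi> differentiable_on UNIV" "\<eta> differentiable_on UNIV"
    using assms by (auto simp: C1_def)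
  have o: "partial_deriv i \<psi> x = 0" if "x \<notin> S" for x
    by (rule partial_deriv_outside[of S]) (use assms that in \<open>auto intro: compact_imp_closed\<close>)
  note cont = C1_continuous[OF assms(1)] C1_continuous[OF assms(2)]
    C1_continuous_partial[OF assms(1)] C1_continuous_partial[OF assms(2)]
  have "integrable lebesgue (\<lambda>x. \<psi> x * partial_deriv i \<eta> x)"
    by (rule integrable_lebesgue_compact_support[of _ S], intro continuous_on_mult cont)
       (use assms in simp_all)
  moreover have "integrable lebesgue (\<lambda>x. partial_deriv i \<psi> x * \<eta> x)"
    by (rule integrable_lebesgue_compact_support[of _ S], intro continuous_on_mult cont)
       (use assms o in simp_all)
  moreover have "(LINT x|lebesgue. partial_deriv i (\<lambda>x. \<psi> x * \<eta> x) x) = 0"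
    by (rule integral_partial_deriv_0[of _ S]) (use assms C1_mult in auto)
  ultimately show ?thesis
    by (simp add: partial_deriv_mult[OF d])
qed

section \<open>Square-integrable functions\<close>

lemma L2_measurable: "f \<in> L2 D \<Longrightarrow> f \<in> borel_measurable (lebesgue_on D)"
  by (simp add: L2_def)

lemma L2_square_integrable: "f \<in> L2 D \<Longrightarrow> integrable (lebesgue_on D) (\<lambda>x. (norm (f x))\<^sup>2)"
  by (simp add: L2_def)

lemma L2_dominated:
  fixes f :: "real^'d \<Rightarrow> 'b::euclidean_space"
  assumes "f \<in> borel_measurable (lebesgue_on D)" "integrable (lebesgue_on D) h"
    "AE x in lebesgue_on D. (norm (f x))\<^sup>2 \<le> h x"
  shows "f \<in> L2 D"
  unfolding L2_def mem_Collect_eq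
proof
  show "integrable (lebesgue_on D) (\<lambda>x. (norm (f x))\<^sup>2)"
  proof (rule Bochner_Integration.integrable_bound[OF assms(2)])
    show "(\<lambda>x. (norm (f x))\<^sup>2) \<in> borel_measurable (lebesgue_on D)"
      using assms(1) by simp
    show "AE x in lebesgue_on D. norm ((norm (f x))\<^sup>2) \<le> norm (h x)"
      using assms(3) by (rule eventually_mono) auto
  qed
qed (rule assms(1))

lemma L2_inner_integrable:
  fixes f g :: "real^'d \<Rightarrow> 'b::euclidean_space"
  assumes "f \<in> L2 D" "g \<in> L2 D"
  shows "integrable (lebesgue_on D) (\<lambda>x. f x \<bullet> g x)"
proof (rule Bochner_Integration.integrable_bound)
  show "integrable (lebesgue_on D) (\<lambda>x. (norm (f x))\<^sup>2 + (norm (g x))\<^sup>2)"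
    using assms by (auto intro: L2_square_integrable)
  show "(\<lambda>x. f x \<bullet> g x) \<in> borel_measurable (lebesgue_on D)"
    using assms by (auto intro: L2_measurable borel_measurable_inner)
  show "AE x in lebesgue_on D. norm (f x \<bullet> g x) \<le> norm ((norm (f x))\<^sup>2 + (norm (g x))\<^sup>2)"
  proof (rule AE_I2)
    fix x
    have "\<bar>f x \<bullet> g x\<bar> \<le> norm (f x) * norm (g x)" by (rule Cauchy_Schwarz_ineq2)
    also have "\<dots> \<le> (norm (f x))\<^sup>2 + (norm (g x))\<^sup>2"
      using sum_squares_bound[of "norm (f x)" "norm (g x)"]
        mult_nonneg_nonneg[OF norm_ge_zero[of "f x"] norm_ge_zero[of "g x"]] by linarith
    finally show "norm (f x \<bullet> g x) \<le> norm ((norm (f x))\<^sup>2 + (norm (g x))\<^sup>2)" by simp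
  qed
qed

lemma L2_mult_integrable:
  fixes f g :: "real^'d \<Rightarrow> real"
  shows "f \<in> L2 D \<Longrightarrow> g \<in> L2 D \<Longrightarrow> integrable (lebesgue_on D) (\<lambda>x. f x * g x)"
  using L2_inner_integrable[of f D g] by simp

lemma L2_add:
  fixes f g :: "real^'d \<Rightarrow> 'b::euclidean_space"
  assumes "f \<in> L2 D" "g \<in> L2 D" shows "(\<lambda>x. f x + g x) \<in> L2 D"
proof (rule L2_dominated)
  show "(\<lambda>x. f x + g x) \<in> borel_measurable (lebesgue_on D)"
    using assms by (auto intro: L2_measurable borel_measurable_add)
  show "integrable (lebesgue_on D) (\<lambda>x. (norm (f x))\<^sup>2 + 2 * (f x \<bullet> g x) + (norm (g x))\<^sup>2)"
    by (intro Bochner_Integration.integrable_add integrable_mult_right L2_square_integrable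
        L2_inner_integrable assms)
  show "AE x in lebesgue_on D. (norm (f x + g x))\<^sup>2 \<le> (norm (f x))\<^sup>2 + 2 * (f x \<bullet> g x) + (norm (g x))\<^sup>2"
    by (auto simp: power2_norm_eq_inner inner_add_left inner_add_right inner_commute)
qed

lemma L2_scaleR:
  fixes f :: "real^'d \<Rightarrow> 'b::euclidean_space"
  assumes "f \<in> L2 D" shows "(\<lambda>x. c *\<^sub>R f x) \<in> L2 D"
  using assms by (auto simp: L2_def power_mult_distrib)

lemma L2_diff:
  fixes f g :: "real^'d \<Rightarrow> 'b::euclidean_space"
  assumes "f \<in> L2 D" "g \<in> L2 D" shows "(\<lambda>x. f x - g x) \<in> L2 D"
  using L2_add[OF assms(1) L2_scaleR[OF assms(2), of "-1"]] by simp

lemma L2_component: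
  fixes f :: "real^'d \<Rightarrow> real^'n"
  assumes "f \<in> L2 D" shows "(\<lambda>x. f x $ i) \<in> L2 D"
proof (rule L2_dominated)
  show "(\<lambda>x. f x $ i) \<in> borel_measurable (lebesgue_on D)"
    using borel_measurable_inner[OF L2_measurable[OF assms] borel_measurable_const[of "axis i 1"]]
    by (simp add: inner_axis)
  show "AE x in lebesgue_on D. (norm (f x $ i))\<^sup>2 \<le> (norm (f x))\<^sup>2"
    by (rule AE_I2) (intro power_mono norm_ge_zero Finite_Cartesian_Product.norm_nth_le)
qed (rule L2_square_integrable[OF assms])

lemma L2_bounded:
  fixes f :: "real^'d \<Rightarrow> 'b::euclidean_space"
  assumes "f \<in> borel_measurable (lebesgue_on D)" "D \<in> lmeasurable" "\<And>x. x \<in> D \<Longrightarrow> norm (f x) \<le> B"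
  shows "f \<in> L2 D"
proof (rule L2_dominated[OF assms(1)])
  have "emeasure (lebesgue_on D) (space (lebesgue_on D)) < \<infinity>"
    using fmeasurableD[OF assms(2)] fmeasurableD2[OF assms(2)]
    by (subst emeasure_restrict_space) (simp_all add: top.not_eq_extremum del: emeasure_completion)
  then show "integrable (lebesgue_on D) (\<lambda>x. B\<^sup>2)"
    by (simp add: integrable_iff_bounded ennreal_mult_less_top)
  show "AE x in lebesgue_on D. (norm (f x))\<^sup>2 \<le> B\<^sup>2"
    by (rule AE_I2) (use assms(3) in \<open>auto intro!: power_mono\<close>)
qed

lemma L2_norm_nonneg: "0 \<le> L2_norm D f"
  by (simp add: L2_norm_def)

lemma L2_norm_square: "(L2_norm D f)\<^sup>2 = (LINT x|lebesgue_on D. (norm (f x))\<^sup>2)"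
  by (simp add: L2_norm_def)

lemma L2_norm_scaleR: "L2_norm D (\<lambda>x. c *\<^sub>R f x) = \<bar>c\<bar> * L2_norm D f"
  by (simp add: L2_norm_def power_mult_distrib real_sqrt_mult)

lemma L2_norm_square_add:
  fixes f g :: "real^'d \<Rightarrow> 'b::euclidean_space"
  assumes "f \<in> L2 D" "g \<in> L2 D"
  shows "(L2_norm D (\<lambda>x. f x + g x))\<^sup>2 =
    (L2_norm D f)\<^sup>2 + 2 * (LINT x|lebesgue_on D. f x \<bullet> g x) + (L2_norm D g)\<^sup>2"
proof -
  have "(L2_norm D (\<lambda>x. f x + g x))\<^sup>2 =
      (LINT x|lebesgue_on D. (norm (f x))\<^sup>2 + 2 * (f x \<bullet> g x) + (norm (g x))\<^sup>2)"
    unfolding L2_norm_square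
    by (intro Bochner_Integration.integral_cong)
       (auto simp: power2_norm_eq_inner inner_add_left inner_add_right inner_commute)
  then show ?thesis
    using assms by (simp add: L2_norm_square L2_square_integrable L2_inner_integrable)
qed

text \<open>The quadratic polynomial \<open>t \<mapsto> \<parallel>f + t g\<parallel>\<^sup>2\<close> is nonnegative, which bounds its discriminant.\<close>

lemma L2_Cauchy_Schwarz:
  fixes f g :: "real^'d \<Rightarrow> 'b::euclidean_space"
  assumes "f \<in> L2 D" "g \<in> L2 D"
  shows "\<bar>LINT x|lebesgue_on D. f x \<bullet> g x\<bar> \<le> L2_norm D f * L2_norm D g"
proof -
  define a b c where "a = L2_norm D f" and "b = L2_norm D g" and "c = (LINT x|lebesgue_on D. f x \<bullet> g x)"
  have "0 \<le> a" "0 \<le> b" by (simp_all add: a_def b_def L2_norm_nonneg)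
  have q: "0 \<le> a\<^sup>2 + 2 * t * c + t\<^sup>2 * b\<^sup>2" for t
    using L2_norm_square_add[OF assms(1) L2_scaleR[OF assms(2), of t]]
      zero_le_power2[of "L2_norm D (\<lambda>x. f x + t *\<^sub>R g x)"]
    by (simp add: L2_norm_scaleR power_mult_distrib a_def b_def c_def)
  have "c\<^sup>2 \<le> (a * b)\<^sup>2"
  proof (cases "b = 0")
    case True
    have "c = 0"
    proof (rule ccontr)
      assume "c \<noteq> 0"
      then show False
        \<comment> \<open>The polynomial is affine in \<open>t\<close> here, and takes the value \<open>-1\<close> at this \<open>t\<close>.\<close>
        using q[of "- (a\<^sup>2 + 1) / (2 * c)"] True by (simp add: field_simps)
    qed
    then show ?thesis by simp
  next
    case False
    \<comment> \<open>Evaluation at the minimiser \<open>t = - c / b\<^sup>2\<close>.\<close>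
    have "0 \<le> (a\<^sup>2 + 2 * (- c / b\<^sup>2) * c + (- c / b\<^sup>2)\<^sup>2 * b\<^sup>2) * b\<^sup>2"
      by (rule mult_nonneg_nonneg[OF q]) simp
    also have "\<dots> = (a * b)\<^sup>2 - c\<^sup>2"
      using False by (simp add: field_simps power2_eq_square)
    finally show ?thesis by simp
  qed
  then have "\<bar>c\<bar> \<le> \<bar>a * b\<bar>" by (simp only: abs_le_square_iff)
  then show ?thesis
    using \<open>0 \<le> a\<close> \<open>0 \<le> b\<close> by (simp add: a_def b_def c_def)
qed

lemma L2_norm_triangle:
  fixes f g :: "real^'d \<Rightarrow> 'b::euclidean_space"
  assumes "f \<in> L2 D" "g \<in> L2 D"
  shows "L2_norm D (\<lambda>x. f x + g x) \<le> L2_norm D f + L2_norm D g"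
proof (rule power2_le_imp_le)
  show "(L2_norm D (\<lambda>x. f x + g x))\<^sup>2 \<le> (L2_norm D f + L2_norm D g)\<^sup>2"
    using L2_Cauchy_Schwarz[OF assms] by (simp add: L2_norm_square_add[OF assms] power2_sum)
qed (simp add: L2_norm_nonneg)

lemma L2_norm_cong_AE:
  assumes "f \<in> borel_measurable (lebesgue_on D)" "g \<in> borel_measurable (lebesgue_on D)"
    "AE x in lebesgue_on D. f x = g x"
  shows "L2_norm D f = L2_norm D g"
  unfolding L2_norm_def
  by (intro arg_cong[where f = sqrt] integral_cong_AE)
     (use assms in \<open>auto elim: AE_mp\<close>)

text \<open>Strong convergence implies weak convergence; this is what carries integral identities from test
  functions over to their limits.\<close>

lemma L2_tendsto_integral:
  fixes u v :: "real^'d \<Rightarrow> 'b::euclidean_space"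
  assumes "u \<in> L2 D" "v \<in> L2 D" "\<And>n. w n \<in> L2 D" "(\<lambda>n. L2_norm D (\<lambda>x. u x - w n x)) \<longlonglongrightarrow> 0"
  shows "(\<lambda>n. LINT x|lebesgue_on D. w n x \<bullet> v x) \<longlonglongrightarrow> (LINT x|lebesgue_on D. u x \<bullet> v x)"
proof (rule LIM_zero_cancel, rule Lim_null_comparison)
  show "(\<lambda>n. L2_norm D (\<lambda>x. u x - w n x) * L2_norm D v) \<longlonglongrightarrow> 0"
    using tendsto_mult_left_zero[OF assms(4)] by simp
  have "norm ((LINT x|lebesgue_on D. w n x \<bullet> v x) - (LINT x|lebesgue_on D. u x \<bullet> v x))
      \<le> L2_norm D (\<lambda>x. u x - w n x) * L2_norm D v" for n
    using L2_Cauchy_Schwarz[OF L2_diff[OF assms(1) assms(3)[of n]] assms(2)] assms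
    by (simp add: inner_diff_left L2_inner_integrable abs_minus_commute)
  then show "\<forall>\<^sub>F n in sequentially. norm ((LINT x|lebesgue_on D. w n x \<bullet> v x) -
      (LINT x|lebesgue_on D. u x \<bullet> v x)) \<le> L2_norm D (\<lambda>x. u x - w n x) * L2_norm D v"
    by simp
qed

lemma L2_subset:
  fixes f :: "real^'d \<Rightarrow> 'b::euclidean_space"
  assumes "f \<in> L2 E" "D \<subseteq> E" "D \<in> sets lebesgue" "E \<in> sets lebesgue"
  shows "f \<in> L2 D"
proof -
  have "set_integrable lebesgue D (\<lambda>x. (norm (f x))\<^sup>2)"
  proof (rule set_integrable_subset)
    show "set_integrable lebesgue E (\<lambda>x. (norm (f x))\<^sup>2)"
      using L2_square_integrable[OF assms(1)] assms(4)
      by (simp add: integrable_restrict_space set_integrable_def)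
  qed (use assms in auto)
  then have "integrable (lebesgue_on D) (\<lambda>x. (norm (f x))\<^sup>2)"
    using assms(3) by (simp add: integrable_restrict_space set_integrable_def)
  moreover have "f \<in> borel_measurable (lebesgue_on D)"
    using L2_measurable[OF assms(1)] assms(2) by (rule measurable_restrict_mono)
  ultimately show ?thesis by (simp add: L2_def)
qed

lemma AE_lebesgue_on_subset:
  assumes "AE x in lebesgue_on E. P x" "D \<subseteq> E" "D \<in> sets lebesgue" "E \<in> sets lebesgue"
  shows "AE x in lebesgue_on D. P x"
proof -
  have "AE x in lebesgue. x \<in> E \<longrightarrow> P x"
    using assms by (simp add: AE_restrict_space_iff)
  then have "AE x in lebesgue. x \<in> D \<longrightarrow> P x"
    by (rule AE_mp) (use assms(2) in auto)
  then show ?thesis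
    using assms by (simp add: AE_restrict_space_iff)
qed

section \<open>Uniqueness and calculus of weak gradients\<close>

text \<open>The bump functions converge boundedly to the indicator of the box.\<close>

lemma integral_box_eq_0:
  fixes g :: "real^'d \<Rightarrow> real"
  assumes "open D" "g \<in> L2 D" "cbox a b \<subseteq> D"
    "\<And>\<psi>. \<psi> \<in> test_functions D \<Longrightarrow> (LINT x|lebesgue_on D. g x * \<psi> x) = 0"
  shows "(LINT x|lebesgue_on D. g x * indicator (box a b) x) = 0"
proof -
  have D: "D \<in> sets lebesgue" using assms(1) by simp
  have ind: "(indicator A :: _ \<Rightarrow> real) \<in> L2 D" if "A \<in> lmeasurable" "A \<subseteq> D" for A
  proof (rule L2_dominated)
    show "(indicator A :: _ \<Rightarrow> real) \<in> borel_measurable (lebesgue_on D)"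
      using that by (intro measurable_restrict_space1 borel_measurable_indicator) auto
    have "integrable lebesgue (indicator A :: _ \<Rightarrow> real)"
      using that by (intro integrable_real_indicator) (auto simp: fmeasurable_def)
    moreover have "(\<lambda>x. indicator D x *\<^sub>R indicator A x) = (indicator A :: _ \<Rightarrow> real)"
      using that by (auto simp: fun_eq_iff indicator_def)
    ultimately show "integrable (lebesgue_on D) (indicator A :: _ \<Rightarrow> real)"
      using D by (simp add: integrable_restrict_space)
    show "AE x in lebesgue_on D. (norm (indicator A x :: real))\<^sup>2 \<le> indicator A x"
      by (auto simp: indicator_def)
  qed
  have g[measurable]: "g \<in> borel_measurable (lebesgue_on D)"
    using assms(2) by (rule L2_measurable)
  have "(\<lambda>n. LINT x|lebesgue_on D. g x * bump n a b x) \<longlonglongrightarrow> (LINT x|lebesgue_on D. g x * indicator (box a b) x)"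
  proof (rule integral_dominated_convergence)
    show "(\<lambda>x. g x * indicator (box a b) x) \<in> borel_measurable (lebesgue_on D)"
      by (intro borel_measurable_times g measurable_restrict_space1 borel_measurable_indicator) auto
    show "(\<lambda>x. g x * bump n a b x) \<in> borel_measurable (lebesgue_on D)" for n
    proof (intro borel_measurable_times g measurable_restrict_space1)
      have "continuous_on UNIV (bump n a b)"
        using C_k_bump[of 0 n a b] by simp
      then show "bump n a b \<in> borel_measurable lebesgue"
        by (simp add: borel_measurable_continuous_onI measurable_completion)
    qed
    show "integrable (lebesgue_on D) (\<lambda>x. \<bar>g x * indicator (cbox a b) x\<bar>)"
      using assms(2,3) by (intro integrable_abs L2_mult_integrable ind) auto
    show "AE x in lebesgue_on D. (\<lambda>n. g x * bump n a b x) \<longlonglongrightarrow> g x * indicator (box a b) x"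
      by (intro AE_I2 tendsto_mult tendsto_const bump_tendsto_indicator)
    show "AE x in lebesgue_on D. norm (g x * bump n a b x) \<le> \<bar>g x * indicator (cbox a b) x\<bar>" for n
    proof (rule AE_I2)
      fix x
      have "\<bar>bump n a b x\<bar> \<le> indicator (cbox a b) x"
        using bump_bounds[of n a b x] bump_outside[of x a b n] box_subset_cbox[of a b]
        by (auto simp: indicator_def)
      then show "norm (g x * bump n a b x) \<le> \<bar>g x * indicator (cbox a b) x\<bar>"
        by (simp add: abs_mult mult_left_mono)
    qed
  qed
  moreover have "(LINT x|lebesgue_on D. g x * bump n a b x) = 0" for n
    using assms(3,4) by (simp add: bump_test_function)
  ultimately show ?thesis
    by (simp add: LIMSEQ_const_iff)
qed

text \<open>The fundamental lemma of the calculus of variations. The test functions approximate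
  indicators of boxes, and almost every point is a limit of averages over boxes.\<close>

lemma AE_eq_0_if_test_integrals_eq_0:
  fixes g :: "real^'d \<Rightarrow> real"
  assumes "open D" "g \<in> L2 D"
    "\<And>\<psi>. \<psi> \<in> test_functions D \<Longrightarrow> (LINT x|lebesgue_on D. g x * \<psi> x) = 0"
  shows "AE x in lebesgue_on D. g x = 0"
proof -
  have D: "D \<in> sets lebesgue" using assms(1) by simp
  have neg: "negligible {x \<in> cbox c d. g x \<noteq> 0}" if cd: "cbox c d \<subseteq> D" for c d
  proof -
    \<comment> \<open>Truncation makes the function integrable, so that almost every point is a limit of averages.\<close>
    define F where "F x = (if x \<in> cbox c d then g x else 0)" for x
    have "g \<in> L2 (cbox c d)"
      using L2_subset[OF assms(2) cd] D by simp
    moreover have "(\<lambda>x. 1::real) \<in> L2 (cbox c d)"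
      by (rule L2_bounded[where B = 1]) auto
    ultimately have "integrable (lebesgue_on (cbox c d)) g"
      using L2_mult_integrable by fastforce
    then have "set_integrable lebesgue (cbox c d) g"
      by (simp add: integrable_restrict_space set_integrable_def)
    then have F: "integrable lebesgue F"
      unfolding set_integrable_def F_def[abs_def]
      by (rule Bochner_Integration.integrable_cong[THEN iffD1, rotated -1]) (auto simp: indicator_def)
    then have Fs: "set_integrable lebesgue S F" if "S \<in> sets lebesgue" for S
      using that unfolding set_integrable_def by (rule integrable_mult_indicator[rotated])
    then have "F integrable_on cbox a b" for a b
      by (intro set_lebesgue_integral_eq_integral(1)) auto
    then obtain N where N: "negligible N"
      "\<And>x e. \<lbrakk>x \<notin> N; 0 < e\<rbrakk> \<Longrightarrow> \<exists>\<delta>>0. \<forall>h. 0 < h \<and> h < \<delta> \<longrightarrow>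
         norm (integral (cbox x (x + h *\<^sub>R One)) F /\<^sub>R h ^ DIM(real^'d) - F x) < e"
      using integrable_ccontinuous_explicit[of F] by blast
    have "g x = 0" if x: "x \<in> box c d" "x \<notin> N" for x
    proof (rule ccontr)
      assume "g x \<noteq> 0"
      have Fx: "F x = g x" using x(1) box_subset_cbox[of c d] by (auto simp: F_def)
      obtain \<delta> where \<delta>: "\<delta> > 0" "\<And>h. 0 < h \<Longrightarrow> h < \<delta> \<Longrightarrow>
         norm (integral (cbox x (x + h *\<^sub>R One)) F /\<^sub>R h ^ DIM(real^'d) - F x) < \<bar>g x\<bar>"
        using N(2)[OF x(2), of "\<bar>g x\<bar>"] \<open>g x \<noteq> 0\<close> by auto
      obtain r where r: "r > 0" "ball x r \<subseteq> box c d"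
        using open_contains_ball[of "box c d"] x(1) open_box by blast
      \<comment> \<open>Small enough for the averaging cube at \<open>x\<close> to stay inside the box.\<close>
      define h where "h = min (\<delta> / 2) (r / (2 * (norm (One :: real^'d) + 1)))"
      have pos: "norm (One :: real^'d) + 1 > 0" by (smt (verit) norm_ge_zero)
      have "0 < r / (2 * (norm (One :: real^'d) + 1))"
        using r(1) pos by simp
      then have h: "0 < h" "h < \<delta>"
        using \<delta>(1) unfolding h_def by linarith+
      have "cbox x (x + h *\<^sub>R One) \<subseteq> cball x (r / 2)"
      proof
        fix y assume y: "y \<in> cbox x (x + h *\<^sub>R One)"
        have "norm (y - x) \<le> norm (h *\<^sub>R (One :: real^'d))"
          by (rule norm_le_componentwise)
             (use y h in \<open>auto simp: mem_box inner_simps abs_if not_less intro: order_trans\<close>)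
        also have "\<dots> \<le> h * (norm (One :: real^'d) + 1)"
          using h by (simp add: mult_left_mono)
        also have "\<dots> \<le> r / (2 * (norm (One :: real^'d) + 1)) * (norm (One :: real^'d) + 1)"
          using pos by (intro mult_right_mono) (auto simp: h_def)
        also have "\<dots> = r / 2"
          using pos by (metis less_irrefl nonzero_mult_divide_mult_cancel_right times_divide_eq_left)
        finally show "y \<in> cball x (r / 2)" by (simp add: dist_norm norm_minus_commute)
      qed
      then have sub: "cbox x (x + h *\<^sub>R One) \<subseteq> box c d"
        using r by (force simp: subset_eq)
      have "integral (cbox x (x + h *\<^sub>R One)) F = integral (box x (x + h *\<^sub>R One)) F"
        by (simp add: integral_open_interval)
      also have "\<dots> = (LINT y:box x (x + h *\<^sub>R One)|lebesgue. F y)"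
        by (rule set_lebesgue_integral_eq_integral(2)[symmetric], rule Fs) simp
      also have "\<dots> = (LINT y|lebesgue. indicator D y *\<^sub>R (g y * indicator (box x (x + h *\<^sub>R One)) y))"
        unfolding set_lebesgue_integral_def
      proof (intro Bochner_Integration.integral_cong refl)
        fix y
        show "indicator (box x (x + h *\<^sub>R One)) y *\<^sub>R F y =
          indicator D y *\<^sub>R (g y * indicator (box x (x + h *\<^sub>R One)) y)"
          using sub cd box_subset_cbox[of c d] box_subset_cbox[of x "x + h *\<^sub>R One"]
          by (cases "y \<in> box x (x + h *\<^sub>R One)") (auto simp: F_def indicator_def)
      qed
      also have "\<dots> = (LINT y|lebesgue_on D. g y * indicator (box x (x + h *\<^sub>R One)) y)"
        using D by (simp add: integral_restrict_space)
      also have "\<dots> = 0"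
        using sub cd box_subset_cbox[of c d] by (intro integral_box_eq_0 assms) auto
      finally show False
        using \<delta>(2)[OF h] Fx by simp
    qed
    then have "{x \<in> cbox c d. g x \<noteq> 0} \<subseteq> N \<union> (cbox c d - box c d)" by auto
    then show ?thesis
      by (rule negligible_subset[rotated]) (intro negligible_Un N(1) negligible_frontier_interval)
  qed
  obtain \<D> where \<D>: "countable \<D>" "\<And>X. X \<in> \<D> \<Longrightarrow> X \<subseteq> D" "\<And>X. X \<in> \<D> \<Longrightarrow> \<exists>a b. X = cbox a b" "\<Union>\<D> = D"
    using open_countable_Union_open_cbox[OF assms(1)] by (metis PowD subsetD)
  have "negligible (\<Union>X\<in>\<D>. {x \<in> X. g x \<noteq> 0})"
  proof (rule negligible_countable_Union)
    show "countable ((\<lambda>X. {x \<in> X. g x \<noteq> 0}) ` \<D>)" using \<D>(1) by simp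
  qed (use neg \<D> in force)
  moreover have "(\<Union>X\<in>\<D>. {x \<in> X. g x \<noteq> 0}) = {x \<in> D. g x \<noteq> 0}"
    using \<D>(4) by auto
  ultimately have "{x \<in> D. g x \<noteq> 0} \<in> null_sets lebesgue"
    by (simp add: negligible_iff_null_sets)
  then have "AE x in lebesgue. x \<in> D \<longrightarrow> g x = 0"
    by (rule AE_I') auto
  then show ?thesis
    using D by (simp add: AE_restrict_space_iff)
qed

lemma test_function_C1: "\<psi> \<in> test_functions D \<Longrightarrow> C1 \<psi>"
  by (auto simp: test_functions_def intro: C1_if_C_k)

lemma grad_component: "grad f x $ i = partial_deriv i f x"
  by (simp add: grad_def)

lemma continuous_on_grad: "C1 f \<Longrightarrow> continuous_on S (grad f)"
  unfolding grad_def[abs_def] by (intro continuous_on_vec_lambda C1_continuous_partial)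

lemma lebesgue_measurable_if_continuous:
  "continuous_on UNIV f \<Longrightarrow> f \<in> borel_measurable (lebesgue_on D)"
  by (intro measurable_restrict_space1 measurable_completion)
     (simp add: borel_measurable_continuous_onI)

lemma L2_continuous:
  fixes f :: "real^'d \<Rightarrow> 'b::euclidean_space"
  assumes "continuous_on UNIV f" "open D" "bounded D"
  shows "f \<in> L2 D"
proof -
  have "bounded (f ` closure D)"
    using assms by (intro compact_imp_bounded compact_continuous_image)
      (auto intro: continuous_on_subset)
  then obtain B where "\<forall>y\<in>f ` closure D. norm y \<le> B"
    unfolding bounded_iff by blast
  then have "norm (f x) \<le> B" if "x \<in> D" for x
    using that closure_subset by blast
  then show ?thesis
    using assms by (intro L2_bounded lebesgue_measurable_if_continuous lmeasurable_open) auto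
qed

lemma L2_test_function:
  assumes "\<psi> \<in> test_functions D" "open E" "bounded E"
  shows "\<psi> \<in> L2 E" "grad \<psi> \<in> L2 E" "partial_deriv i \<psi> \<in> L2 E"
proof -
  note C1 = test_function_C1[OF assms(1)]
  show "\<psi> \<in> L2 E" using C1_continuous[OF C1] assms(2,3) by (rule L2_continuous)
  show "grad \<psi> \<in> L2 E" using continuous_on_grad[OF C1] assms(2,3) by (rule L2_continuous)
  show "partial_deriv i \<psi> \<in> L2 E" using C1_continuous_partial[OF C1] assms(2,3) by (rule L2_continuous)
qed

lemma integral_lebesgue_on_eq:
  fixes f :: "real^'d \<Rightarrow> real"
  assumes "D \<in> sets lebesgue" "\<And>x. x \<notin> D \<Longrightarrow> f x = 0"
  shows "(LINT x|lebesgue_on D. f x) = (LINT x|lebesgue. f x)"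
proof -
  have "(\<lambda>x. indicator D x *\<^sub>R f x) = f"
    using assms(2) by (auto simp: indicator_def fun_eq_iff)
  then show ?thesis
    using assms(1) by (simp add: integral_restrict_space)
qed

lemma test_function_integration_by_parts:
  fixes \<psi> \<eta> :: "real^'d \<Rightarrow> real"
  assumes "open D" "\<psi> \<in> test_functions D" "C1 \<eta>"
  shows "(LINT x|lebesgue_on D. \<psi> x * partial_deriv i \<eta> x) = - (LINT x|lebesgue_on D. partial_deriv i \<psi> x * \<eta> x)"
proof -
  obtain S where S: "\<And>k. C_k k \<psi>" "compact S" "S \<subseteq> D" "\<And>x. x \<notin> S \<Longrightarrow> \<psi> x = 0"
    using assms(2) by (rule test_functionsD) blast
  have o: "partial_deriv i \<psi> x = 0" if "x \<notin> S" for x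
    using compact_imp_closed[OF S(2)] S(4) that by (rule partial_deriv_outside)
  have "(LINT x|lebesgue_on D. \<psi> x * partial_deriv i \<eta> x) = (LINT x|lebesgue. \<psi> x * partial_deriv i \<eta> x)"
    using assms(1) S(3,4) by (intro integral_lebesgue_on_eq) auto
  moreover have "(LINT x|lebesgue_on D. partial_deriv i \<psi> x * \<eta> x) = (LINT x|lebesgue. partial_deriv i \<psi> x * \<eta> x)"
    using assms(1) S(3) o by (intro integral_lebesgue_on_eq) auto
  ultimately show ?thesis
    using integration_by_parts[OF test_function_C1[OF assms(2)] assms(3) S(2,4)] by simp
qed

lemma C1_weak_gradient:
  fixes \<eta> :: "real^'d \<Rightarrow> real"
  assumes "open D" "bounded D" "C1 \<eta>"
  shows "has_weak_gradient D \<eta> (grad \<eta>)"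
  unfolding has_weak_gradient_def
proof (intro conjI ballI allI)
  show "\<eta> \<in> L2 D" "grad \<eta> \<in> L2 D"
    using assms by (auto intro: L2_continuous C1_continuous continuous_on_grad)
  fix \<psi> :: "real^'d \<Rightarrow> real" and i assume "\<psi> \<in> test_functions D"
  from test_function_integration_by_parts[OF assms(1) this assms(3), of i]
  show "(LINT x|lebesgue_on D. \<eta> x * partial_deriv i \<psi> x) = - (LINT x|lebesgue_on D. grad \<eta> x $ i * \<psi> x)"
    by (simp add: grad_component mult.commute)
qed

lemma weak_gradient_L2:
  assumes "has_weak_gradient D u g" shows "u \<in> L2 D" "g \<in> L2 D"
  using assms by (simp_all add: has_weak_gradient_def)

lemma weak_gradient_unique:
  assumes "open D" "bounded D" "has_weak_gradient D u g" "has_weak_gradient D u h"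
  shows "AE x in lebesgue_on D. g x = h x"
proof -
  have "AE x in lebesgue_on D. g x $ i - h x $ i = 0" for i
  proof (rule AE_eq_0_if_test_integrals_eq_0[OF assms(1)])
    have gi: "(\<lambda>x. g x $ i) \<in> L2 D" "(\<lambda>x. h x $ i) \<in> L2 D"
      using assms by (auto intro: L2_component weak_gradient_L2)
    then show "(\<lambda>x. g x $ i - h x $ i) \<in> L2 D" by (rule L2_diff)
    fix \<psi> assume \<psi>: "\<psi> \<in> test_functions D"
    then have "(LINT x|lebesgue_on D. g x $ i * \<psi> x) = (LINT x|lebesgue_on D. h x $ i * \<psi> x)"
      using assms(3,4) by (simp add: has_weak_gradient_def)
    then show "(LINT x|lebesgue_on D. (g x $ i - h x $ i) * \<psi> x) = 0"
      using L2_mult_integrable[OF gi(1) L2_test_function(1)[OF \<psi> assms(1,2)]]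
        L2_mult_integrable[OF gi(2) L2_test_function(1)[OF \<psi> assms(1,2)]]
      by (simp add: left_diff_distrib)
  qed
  then have "AE x in lebesgue_on D. \<forall>i. g x $ i - h x $ i = 0"
    by (simp add: AE_all_countable)
  then show ?thesis
    by (rule eventually_mono) (simp add: vec_eq_iff)
qed

lemma has_weak_gradient_weak_gradient: "u \<in> H1 D \<Longrightarrow> has_weak_gradient D u (weak_gradient D u)"
  unfolding weak_gradient_def H1_def by (simp add: someI_ex)

lemma weak_gradient_AE_eq:
  assumes "open D" "bounded D" "has_weak_gradient D u g"
  shows "AE x in lebesgue_on D. weak_gradient D u x = g x"
proof (rule weak_gradient_unique[OF assms(1,2) _ assms(3)])
  show "has_weak_gradient D u (weak_gradient D u)"
    using assms(3) by (intro has_weak_gradient_weak_gradient) (auto simp: H1_def)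
qed

lemma has_weak_gradient_add:
  assumes "open D" "bounded D" "has_weak_gradient D u g" "has_weak_gradient D v h"
  shows "has_weak_gradient D (\<lambda>x. u x + v x) (\<lambda>x. g x + h x)"
  unfolding has_weak_gradient_def
proof (intro conjI ballI allI)
  note L2 = weak_gradient_L2[OF assms(3)] weak_gradient_L2[OF assms(4)]
  show "(\<lambda>x. u x + v x) \<in> L2 D" "(\<lambda>x. g x + h x) \<in> L2 D"
    by (intro L2_add L2)+
  fix \<psi> i assume \<psi>: "\<psi> \<in> test_functions D"
  note L2\<psi> = L2_test_function[OF \<psi> assms(1,2)]
  have "(LINT x|lebesgue_on D. u x * partial_deriv i \<psi> x) = - (LINT x|lebesgue_on D. g x $ i * \<psi> x)"
    "(LINT x|lebesgue_on D. v x * partial_deriv i \<psi> x) = - (LINT x|lebesgue_on D. h x $ i * \<psi> x)"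
    using assms(3,4) \<psi> by (simp_all add: has_weak_gradient_def)
  then show "(LINT x|lebesgue_on D. (u x + v x) * partial_deriv i \<psi> x) =
      - (LINT x|lebesgue_on D. (g x + h x) $ i * \<psi> x)"
    by (simp add: distrib_right L2_mult_integrable L2 L2\<psi> L2_component)
qed

lemma has_weak_gradient_cmult:
  assumes "has_weak_gradient D u g"
  shows "has_weak_gradient D (\<lambda>x. c * u x) (\<lambda>x. c *\<^sub>R g x)"
proof -
  have "(\<lambda>x. c * u x) \<in> L2 D" "(\<lambda>x. c *\<^sub>R g x) \<in> L2 D"
    using L2_scaleR[OF weak_gradient_L2(1)[OF assms], of c] L2_scaleR[OF weak_gradient_L2(2)[OF assms], of c]
    by simp_all
  then show ?thesis
    using assms by (simp add: has_weak_gradient_def mult.assoc)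
qed

lemma has_weak_gradient_diff:
  assumes "open D" "bounded D" "has_weak_gradient D u g" "has_weak_gradient D v h"
  shows "has_weak_gradient D (\<lambda>x. u x - v x) (\<lambda>x. g x - h x)"
  using has_weak_gradient_add[OF assms(1-3) has_weak_gradient_cmult[OF assms(4), of "-1"]] by simp

lemma has_weak_gradient_subset:
  fixes u :: "real^'d \<Rightarrow> real"
  assumes "open D" "open E" "D \<subseteq> E" "has_weak_gradient E u g"
  shows "has_weak_gradient D u g"
  unfolding has_weak_gradient_def
proof (intro conjI ballI allI)
  show "u \<in> L2 D" "g \<in> L2 D"
    using assms weak_gradient_L2[OF assms(4)] by (auto intro: L2_subset)
  fix \<psi> :: "real^'d \<Rightarrow> real" and i assume \<psi>: "\<psi> \<in> test_functions D"
  then obtain S where S: "\<And>k. C_k k \<psi>" "compact S" "S \<subseteq> D" "\<And>x. x \<notin> S \<Longrightarrow> \<psi> x = 0"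
    by (rule test_functionsD) blast
  have o: "partial_deriv i \<psi> x = 0" if "x \<notin> S" for x
    using compact_imp_closed[OF S(2)] S(4) that by (rule partial_deriv_outside)
  have eq: "(LINT x|lebesgue_on D. f x) = (LINT x|lebesgue_on E. f x)"
    if "\<And>x. x \<notin> S \<Longrightarrow> f x = 0" for f :: "real^'d \<Rightarrow> real"
  proof -
    have "(LINT x|lebesgue_on D. f x) = (LINT x|lebesgue. f x)"
      using assms(1) S(3) that by (intro integral_lebesgue_on_eq) auto
    also have "\<dots> = (LINT x|lebesgue_on E. f x)"
      using assms(2,3) S(3) that by (intro integral_lebesgue_on_eq[symmetric]) auto
    finally show ?thesis .
  qed
  have "(LINT x|lebesgue_on D. u x * partial_deriv i \<psi> x) = (LINT x|lebesgue_on E. u x * partial_deriv i \<psi> x)"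
    by (rule eq) (simp add: o)
  moreover have "(LINT x|lebesgue_on D. g x $ i * \<psi> x) = (LINT x|lebesgue_on E. g x $ i * \<psi> x)"
    by (rule eq) (simp add: S(4))
  ultimately show "(LINT x|lebesgue_on D. u x * partial_deriv i \<psi> x) = - (LINT x|lebesgue_on D. g x $ i * \<psi> x)"
    using assms(4) \<psi> test_functions_mono[OF assms(3)] by (auto simp: has_weak_gradient_def)
qed

text \<open>The choice of a weak gradient in the definition of the norm, and of the bilinear form below, is
  irrelevant because the candidates agree almost everywhere.\<close>

lemma H1_norm_eq:
  assumes "open D" "bounded D" "has_weak_gradient D u g"
  shows "H1_norm D u = sqrt ((L2_norm D u)\<^sup>2 + (L2_norm D g)\<^sup>2)"
proof -
  have "u \<in> H1 D" using assms(3) by (auto simp: H1_def)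
  then have "L2_norm D (weak_gradient D u) = L2_norm D g"
    by (intro L2_norm_cong_AE weak_gradient_AE_eq[OF assms]
        L2_measurable[OF weak_gradient_L2(2)[OF assms(3)]]
        L2_measurable[OF weak_gradient_L2(2)[OF has_weak_gradient_weak_gradient]])
  then show ?thesis by (simp add: H1_norm_def)
qed

lemma borel_measurable_matrix_vector_mult:
  fixes A :: "'a \<Rightarrow> real^'n^'m"
  assumes "A \<in> borel_measurable M" "v \<in> borel_measurable M"
  shows "(\<lambda>x. A x *v v x) \<in> borel_measurable M"
  by (rule borel_measurable_continuous_Pair[OF assms])
     (unfold matrix_vector_mult_def, intro continuous_intros)

lemma a_form_eq:
  assumes "open D" "bounded D" "A \<in> borel_measurable (lebesgue_on D)"
    "has_weak_gradient D u g" "has_weak_gradient D v h"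
  shows "a_form A D u v = (LINT x|lebesgue_on D. h x \<bullet> (A x *v g x))"
proof -
  have m: "(\<lambda>x. p x \<bullet> (A x *v q x)) \<in> borel_measurable (lebesgue_on D)"
    if "p \<in> L2 D" "q \<in> L2 D" for p q
  proof -
    have "(\<lambda>x. A x *v q x) \<in> borel_measurable (lebesgue_on D)"
      using assms(3) L2_measurable[OF that(2)] by (rule borel_measurable_matrix_vector_mult)
    then show ?thesis
      using L2_measurable[OF that(1)] by (intro borel_measurable_inner)
  qed
  note wg = has_weak_gradient_weak_gradient[of u D] has_weak_gradient_weak_gradient[of v D]
  have H: "u \<in> H1 D" "v \<in> H1 D" using assms by (auto simp: H1_def)
  show ?thesis
    unfolding a_form_def
  proof (rule integral_cong_AE)
    show "AE x in lebesgue_on D. weak_gradient D v x \<bullet> (A x *v weak_gradient D u x) = h x \<bullet> (A x *v g x)"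
      using weak_gradient_AE_eq[OF assms(1,2,4)] weak_gradient_AE_eq[OF assms(1,2,5)]
      by eventually_elim simp
  qed (intro m weak_gradient_L2[OF assms(4)] weak_gradient_L2[OF assms(5)]
       weak_gradient_L2[OF wg(1)[OF H(1)]] weak_gradient_L2[OF wg(2)[OF H(2)]])+
qed

section \<open>The space H10\<close>

text \<open>This and the following lemma express membership in \<open>H10\<close> by two separate limits in \<open>L\<^sup>2\<close>, one for the
  function and one for an arbitrary weak gradient of it.\<close>

lemma H10_approximation:
  assumes "open D" "bounded D" "u \<in> H10 D" "has_weak_gradient D u g"
  obtains \<psi> where "\<And>n. \<psi> n \<in> test_functions D"
    "(\<lambda>n. L2_norm D (\<lambda>x. u x - \<psi> n x)) \<longlonglongrightarrow> 0"
    "(\<lambda>n. L2_norm D (\<lambda>x. g x - grad (\<psi> n) x)) \<longlonglongrightarrow> 0"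
proof -
  obtain \<psi> where \<psi>: "\<And>n. \<psi> n \<in> test_functions D" "(\<lambda>n. H1_norm D (\<lambda>x. u x - \<psi> n x)) \<longlonglongrightarrow> 0"
    using assms(3) unfolding H10_def by blast
  have wg: "has_weak_gradient D (\<lambda>x. u x - \<psi> n x) (\<lambda>x. g x - grad (\<psi> n) x)" for n
    by (intro has_weak_gradient_diff assms C1_weak_gradient test_function_C1[OF \<psi>(1)])
  have le: "L2_norm D (\<lambda>x. u x - \<psi> n x) \<le> H1_norm D (\<lambda>x. u x - \<psi> n x)"
    "L2_norm D (\<lambda>x. g x - grad (\<psi> n) x) \<le> H1_norm D (\<lambda>x. u x - \<psi> n x)" for n
    unfolding H1_norm_eq[OF assms(1,2) wg] by (simp_all add: real_le_rsqrt)
  have "(\<lambda>n. L2_norm D (\<lambda>x. u x - \<psi> n x)) \<longlonglongrightarrow> 0"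
    by (rule tendsto_sandwich[OF _ _ tendsto_const \<psi>(2)]) (simp_all add: L2_norm_nonneg le)
  moreover have "(\<lambda>n. L2_norm D (\<lambda>x. g x - grad (\<psi> n) x)) \<longlonglongrightarrow> 0"
    by (rule tendsto_sandwich[OF _ _ tendsto_const \<psi>(2)]) (simp_all add: L2_norm_nonneg le)
  ultimately show thesis using \<psi>(1) that by blast
qed

lemma H10_I:
  assumes "open D" "bounded D" "has_weak_gradient D u g" "\<And>n. \<psi> n \<in> test_functions D"
    "(\<lambda>n. L2_norm D (\<lambda>x. u x - \<psi> n x)) \<longlonglongrightarrow> 0"
    "(\<lambda>n. L2_norm D (\<lambda>x. g x - grad (\<psi> n) x)) \<longlonglongrightarrow> 0"
  shows "u \<in> H10 D"
proof -
  have wg: "has_weak_gradient D (\<lambda>x. u x - \<psi> n x) (\<lambda>x. g x - grad (\<psi> n) x)" for n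
    by (intro has_weak_gradient_diff assms C1_weak_gradient test_function_C1[OF assms(4)])
  have "(\<lambda>n. sqrt ((L2_norm D (\<lambda>x. u x - \<psi> n x))\<^sup>2 + (L2_norm D (\<lambda>x. g x - grad (\<psi> n) x))\<^sup>2)) \<longlonglongrightarrow> sqrt (0\<^sup>2 + 0\<^sup>2)"
    by (intro tendsto_intros assms)
  then have "(\<lambda>n. H1_norm D (\<lambda>x. u x - \<psi> n x)) \<longlonglongrightarrow> 0"
    by (simp add: H1_norm_eq[OF assms(1,2) wg])
  then show ?thesis
    using assms(3,4) by (auto simp: H10_def H1_def)
qed

lemma H10_imp_H1: "u \<in> H10 D \<Longrightarrow> u \<in> H1 D"
  by (simp add: H10_def)

lemma H10_obtain_gradient:
  assumes "u \<in> H10 D"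
  obtains g where "has_weak_gradient D u g"
  using H10_imp_H1[OF assms] by (auto simp: H1_def)

lemma grad_add: "C1 f \<Longrightarrow> C1 g \<Longrightarrow> grad (\<lambda>x. f x + g x) = (\<lambda>x. grad f x + grad g x)"
  by (simp add: fun_eq_iff vec_eq_iff grad_component C1_def partial_deriv_add)

lemma C1_const: "C1 (\<lambda>x::real^'d. c)"
  using C1_affine[of 0 c] by simp

lemma grad_cmult:
  assumes "C1 f" shows "grad (\<lambda>x. c * f x) = (\<lambda>x. c *\<^sub>R grad f x)"
  using partial_deriv_mult[of "\<lambda>x. c" f] assms C1_const[of c]
  by (simp add: fun_eq_iff vec_eq_iff grad_component C1_def partial_deriv_const)

lemma H10_add:
  assumes D: "open D" "bounded D" and "u \<in> H10 D" "v \<in> H10 D"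
  shows "(\<lambda>x. u x + v x) \<in> H10 D"
proof -
  obtain g h where g: "has_weak_gradient D u g" and h: "has_weak_gradient D v h"
    using assms by (meson H10_obtain_gradient)
  obtain \<psi> where \<psi>: "\<And>n. \<psi> n \<in> test_functions D"
    "(\<lambda>n. L2_norm D (\<lambda>x. u x - \<psi> n x)) \<longlonglongrightarrow> 0"
    "(\<lambda>n. L2_norm D (\<lambda>x. g x - grad (\<psi> n) x)) \<longlonglongrightarrow> 0"
    using H10_approximation[OF D assms(3) g] by blast
  obtain \<eta> where \<eta>: "\<And>n. \<eta> n \<in> test_functions D"
    "(\<lambda>n. L2_norm D (\<lambda>x. v x - \<eta> n x)) \<longlonglongrightarrow> 0"
    "(\<lambda>n. L2_norm D (\<lambda>x. h x - grad (\<eta> n) x)) \<longlonglongrightarrow> 0"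
    using H10_approximation[OF D assms(4) h] by blast
  have lim: "(\<lambda>n. L2_norm D (\<lambda>x. (p x + q x) - (P n x + Q n x))) \<longlonglongrightarrow> 0"
    if "p \<in> L2 D" "q \<in> L2 D" "\<And>n. P n \<in> L2 D" "\<And>n. Q n \<in> L2 D"
      "(\<lambda>n. L2_norm D (\<lambda>x. p x - P n x)) \<longlonglongrightarrow> 0" "(\<lambda>n. L2_norm D (\<lambda>x. q x - Q n x)) \<longlonglongrightarrow> 0"
    for p q :: "_ \<Rightarrow> 'b::euclidean_space" and P Q
  proof (rule tendsto_sandwich[OF _ _ tendsto_const])
    show "(\<lambda>n. L2_norm D (\<lambda>x. p x - P n x) + L2_norm D (\<lambda>x. q x - Q n x)) \<longlonglongrightarrow> 0"
      using tendsto_add[OF that(5,6)] by simp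
    have "L2_norm D (\<lambda>x. (p x + q x) - (P n x + Q n x)) \<le> L2_norm D (\<lambda>x. p x - P n x) + L2_norm D (\<lambda>x. q x - Q n x)" for n
      using L2_norm_triangle[OF L2_diff[OF that(1,3)] L2_diff[OF that(2,4)], of n n]
      by (simp add: algebra_simps)
    then show "\<forall>\<^sub>F n in sequentially. L2_norm D (\<lambda>x. (p x + q x) - (P n x + Q n x)) \<le>
        L2_norm D (\<lambda>x. p x - P n x) + L2_norm D (\<lambda>x. q x - Q n x)" by simp
  qed (simp add: L2_norm_nonneg)
  show ?thesis
  proof (rule H10_I[OF D has_weak_gradient_add[OF D g h]])
    show "(\<lambda>x. \<psi> n x + \<eta> n x) \<in> test_functions D" for n
      by (intro test_functions_add \<psi> \<eta>)
    show "(\<lambda>n. L2_norm D (\<lambda>x. u x + v x - (\<psi> n x + \<eta> n x))) \<longlonglongrightarrow> 0"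
      by (intro lim weak_gradient_L2[OF g] weak_gradient_L2[OF h]
          L2_test_function[OF \<psi>(1) D] L2_test_function[OF \<eta>(1) D] \<psi> \<eta>)
    show "(\<lambda>n. L2_norm D (\<lambda>x. g x + h x - grad (\<lambda>x. \<psi> n x + \<eta> n x) x)) \<longlonglongrightarrow> 0"
      unfolding grad_add[OF test_function_C1[OF \<psi>(1)] test_function_C1[OF \<eta>(1)]]
      by (intro lim weak_gradient_L2[OF g] weak_gradient_L2[OF h]
          L2_test_function[OF \<psi>(1) D] L2_test_function[OF \<eta>(1) D] \<psi> \<eta>)
  qed
qed

lemma H10_cmult:
  assumes D: "open D" "bounded D" and "u \<in> H10 D"
  shows "(\<lambda>x. c * u x) \<in> H10 D"
proof -
  obtain g where g: "has_weak_gradient D u g"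
    using assms by (meson H10_obtain_gradient)
  obtain \<psi> where \<psi>: "\<And>n. \<psi> n \<in> test_functions D"
    "(\<lambda>n. L2_norm D (\<lambda>x. u x - \<psi> n x)) \<longlonglongrightarrow> 0"
    "(\<lambda>n. L2_norm D (\<lambda>x. g x - grad (\<psi> n) x)) \<longlonglongrightarrow> 0"
    using H10_approximation[OF D assms(3) g] by blast
  show ?thesis
  proof (rule H10_I[OF D has_weak_gradient_cmult[OF g]])
    show "(\<lambda>x. c * \<psi> n x) \<in> test_functions D" for n
      by (intro test_functions_cmult \<psi>)
    show "(\<lambda>n. L2_norm D (\<lambda>x. c * u x - c * \<psi> n x)) \<longlonglongrightarrow> 0"
      using tendsto_mult_right_zero[OF \<psi>(2), of "\<bar>c\<bar>"]
        L2_norm_scaleR[of D c "\<lambda>x. u x - \<psi> n x" for n]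
      by (simp add: right_diff_distrib)
    show "(\<lambda>n. L2_norm D (\<lambda>x. c *\<^sub>R g x - grad (\<lambda>x. c * \<psi> n x) x)) \<longlonglongrightarrow> 0"
      unfolding grad_cmult[OF test_function_C1[OF \<psi>(1)]]
      using tendsto_mult_right_zero[OF \<psi>(3), of "\<bar>c\<bar>"]
        L2_norm_scaleR[of D c "\<lambda>x. g x - grad (\<psi> n) x" for n]
      by (simp add: scaleR_diff_right)
  qed
qed

lemma H10_0:
  assumes "open D" "bounded D" shows "(\<lambda>x::real^'d. 0) \<in> H10 D"
proof (rule H10_I[OF assms C1_weak_gradient[OF assms C1_const]])
  show "(\<lambda>x. 0) \<in> test_functions D"
    by (simp add: test_functions_def C_k_const)
qed (simp_all add: L2_norm_def)

lemma H10_sum: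
  assumes "open D" "bounded D" "\<And>i. i \<in> I \<Longrightarrow> u i \<in> H10 D"
  shows "(\<lambda>x. \<Sum>i\<in>I. c i * u i x) \<in> H10 D"
  using assms(3)
  by (induction I rule: infinite_finite_induct)
     (simp_all add: H10_0[OF assms(1,2)] H10_add[OF assms(1,2)] H10_cmult[OF assms(1,2)])

text \<open>The boundary term vanishes for test functions in place of \<open>u\<close>, hence also in the limit. The
  function \<open>\<eta>\<close> is free on the boundary of \<open>D\<close>: it will be a constant, or a test function of a larger
  domain.\<close>

lemma H10_Green:
  fixes \<eta> :: "real^'d \<Rightarrow> real"
  assumes D: "open D" "bounded D" and u: "u \<in> H10 D" and g: "has_weak_gradient D u g" and "C1 \<eta>"
  shows "(LINT x|lebesgue_on D. u x * partial_deriv i \<eta> x) = - (LINT x|lebesgue_on D. g x $ i * \<eta> x)"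
proof -
  obtain \<psi> where \<psi>: "\<And>n. \<psi> n \<in> test_functions D"
    "(\<lambda>n. L2_norm D (\<lambda>x. u x - \<psi> n x)) \<longlonglongrightarrow> 0"
    "(\<lambda>n. L2_norm D (\<lambda>x. g x - grad (\<psi> n) x)) \<longlonglongrightarrow> 0"
    using H10_approximation[OF D u g] by blast
  have "partial_deriv i \<eta> \<in> L2 D"
    using C1_continuous_partial[OF assms(5)] D by (rule L2_continuous)
  from L2_tendsto_integral[OF weak_gradient_L2(1)[OF g] this L2_test_function(1)[OF \<psi>(1) D] \<psi>(2)]
  have 1: "(\<lambda>n. LINT x|lebesgue_on D. \<psi> n x * partial_deriv i \<eta> x) \<longlonglongrightarrow> (LINT x|lebesgue_on D. u x * partial_deriv i \<eta> x)"
    by simp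
  have "(\<lambda>x. \<eta> x *\<^sub>R axis i (1::real)) \<in> L2 D"
    by (intro L2_continuous D continuous_intros C1_continuous assms(5))
  from L2_tendsto_integral[OF weak_gradient_L2(2)[OF g] this L2_test_function(2)[OF \<psi>(1) D] \<psi>(3)]
  have 2: "(\<lambda>n. LINT x|lebesgue_on D. partial_deriv i (\<psi> n) x * \<eta> x) \<longlonglongrightarrow> (LINT x|lebesgue_on D. g x $ i * \<eta> x)"
    by (simp add: inner_axis grad_component mult.commute)
  have "(\<lambda>n. LINT x|lebesgue_on D. \<psi> n x * partial_deriv i \<eta> x) \<longlonglongrightarrow> - (LINT x|lebesgue_on D. g x $ i * \<eta> x)"
    using tendsto_minus[OF 2] by (simp add: test_function_integration_by_parts[OF D(1) \<psi>(1) assms(5)])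
  with 1 show ?thesis by (rule LIMSEQ_unique)
qed

text \<open>Green's formula against the constant function \<open>1\<close>.\<close>

lemma H10_mean_gradient_0:
  assumes D: "open D" "bounded D" and u: "u \<in> H10 D" and g: "has_weak_gradient D u g"
  shows "(LINT x|lebesgue_on D. g x \<bullet> a) = 0"
proof -
  have "(LINT x|lebesgue_on D. g x $ i) = 0" for i
    using H10_Green[OF D u g C1_const[of 1]] by (simp add: partial_deriv_const)
  moreover have "integrable (lebesgue_on D) (\<lambda>x. g x $ i)" for i
    using L2_mult_integrable[OF L2_component[OF weak_gradient_L2(2)[OF g]]
        L2_continuous[OF continuous_on_const D, of "1::real"]] by simp
  ultimately show ?thesis
    by (simp add: inner_vec_def)
qed

lemma L2_norm_mono:
  fixes f :: "real^'d \<Rightarrow> 'b::euclidean_space" and g :: "real^'d \<Rightarrow> 'c::euclidean_space"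
  assumes "f \<in> L2 D" "g \<in> L2 D" "0 \<le> c" "\<And>x. x \<in> D \<Longrightarrow> norm (f x) \<le> c * norm (g x)"
  shows "L2_norm D f \<le> c * L2_norm D g"
proof (rule power2_le_imp_le)
  have "(L2_norm D f)\<^sup>2 \<le> (LINT x|lebesgue_on D. c\<^sup>2 * (norm (g x))\<^sup>2)"
    unfolding L2_norm_square
  proof (rule integral_mono)
    fix x assume "x \<in> space (lebesgue_on D)"
    then have "(norm (f x))\<^sup>2 \<le> (c * norm (g x))\<^sup>2"
      by (intro power_mono assms(4)) auto
    then show "(norm (f x))\<^sup>2 \<le> c\<^sup>2 * (norm (g x))\<^sup>2" by (simp add: power_mult_distrib)
  qed (intro integrable_mult_right L2_square_integrable assms)+
  then show "(L2_norm D f)\<^sup>2 \<le> (c * L2_norm D g)\<^sup>2"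
    by (simp add: L2_norm_square power_mult_distrib)
qed (simp add: assms L2_norm_nonneg)

text \<open>Integrating \<open>\<psi>\<^sup>2 = \<psi>\<^sup>2 \<partial>\<^sub>i (x\<^sub>i - c\<^sub>i)\<close> by parts, with \<open>c\<close> in \<open>D\<close>, produces the factor \<open>x\<^sub>i - c\<^sub>i\<close>,
  which the diameter bounds.\<close>

lemma Poincare_test_function:
  assumes D: "open D" "bounded D" and \<psi>: "\<psi> \<in> test_functions D"
  shows "L2_norm D \<psi> \<le> 2 * diameter D * L2_norm D (grad \<psi>)"
proof (cases "D = {}")
  case True
  then show ?thesis by (simp add: L2_norm_def integral_restrict_space)
next
  case False
  then obtain c where c: "c \<in> D" by blast
  define i :: 'a where "i = undefined"
  define l where "l x = axis i 1 \<bullet> x + - (axis i 1 \<bullet> c)" for x :: "real^'a"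
  note L2\<psi> = L2_test_function[OF \<psi> D]
  have C1: "C1 \<psi>" "C1 l" "C1 (\<lambda>x. \<psi> x * l x)"
    using test_function_C1[OF \<psi>] C1_affine[of "axis i 1" "- (axis i 1 \<bullet> c)"]
    by (auto simp: l_def[abs_def] intro: C1_mult)
  have cl: "continuous_on UNIV (\<lambda>x. partial_deriv i \<psi> x * l x)"
    by (intro continuous_intros C1_continuous_partial C1_continuous C1)
  have pl: "(\<lambda>x. partial_deriv i \<psi> x * l x) \<in> L2 D"
    using cl D by (rule L2_continuous)
  have "partial_deriv i (\<lambda>x. \<psi> x * l x) = (\<lambda>x. \<psi> x + partial_deriv i \<psi> x * l x)"
    using partial_deriv_mult[of \<psi> l i] C1 partial_deriv_affine[of i "axis i 1" "- (axis i 1 \<bullet> c)"]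
    by (simp add: C1_def l_def[abs_def])
  then have "(LINT x|lebesgue_on D. \<psi> x * (\<psi> x + partial_deriv i \<psi> x * l x)) =
      - (LINT x|lebesgue_on D. partial_deriv i \<psi> x * (\<psi> x * l x))"
    using test_function_integration_by_parts[OF D(1) \<psi> C1(3), of i] by simp
  moreover have "(LINT x|lebesgue_on D. partial_deriv i \<psi> x * (\<psi> x * l x)) =
      (LINT x|lebesgue_on D. \<psi> x * (partial_deriv i \<psi> x * l x))"
    by (simp add: ac_simps)
  moreover have "(LINT x|lebesgue_on D. \<psi> x * (\<psi> x + partial_deriv i \<psi> x * l x)) =
      (L2_norm D \<psi>)\<^sup>2 + (LINT x|lebesgue_on D. \<psi> x * (partial_deriv i \<psi> x * l x))"
    using L2_mult_integrable[OF L2\<psi>(1) L2\<psi>(1)] L2_mult_integrable[OF L2\<psi>(1) pl]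
    by (simp add: distrib_left L2_norm_square) (simp add: power2_eq_square)
  ultimately have "(L2_norm D \<psi>)\<^sup>2 \<le> 2 * \<bar>LINT x|lebesgue_on D. \<psi> x * (partial_deriv i \<psi> x * l x)\<bar>"
    by linarith
  also have "\<dots> \<le> 2 * (L2_norm D \<psi> * L2_norm D (\<lambda>x. partial_deriv i \<psi> x * l x))"
    using L2_Cauchy_Schwarz[OF L2\<psi>(1) pl] by simp
  also have "\<dots> \<le> 2 * (L2_norm D \<psi> * (diameter D * L2_norm D (grad \<psi>)))"
  proof (intro mult_left_mono L2_norm_mono pl L2\<psi> L2_norm_nonneg diameter_ge_0 D)
    fix x assume "x \<in> D"
    have "l x = (x - c) $ i"
      by (simp add: l_def inner_axis')
    then have "\<bar>l x\<bar> \<le> dist x c"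
      using component_le_norm_cart[of "x - c" i] by (simp add: dist_norm)
    also have "\<dots> \<le> diameter D"
      using D(2) \<open>x \<in> D\<close> c by (rule diameter_bounded_bound)
    finally have "\<bar>l x\<bar> \<le> diameter D" .
    moreover have "\<bar>partial_deriv i \<psi> x\<bar> \<le> norm (grad \<psi> x)"
      using component_le_norm_cart[of "grad \<psi> x" i] by (simp add: grad_component)
    ultimately show "norm (partial_deriv i \<psi> x * l x) \<le> diameter D * norm (grad \<psi> x)"
      by (simp add: abs_mult mult.commute mult_mono)
  qed simp
  finally have "L2_norm D \<psi> * L2_norm D \<psi> \<le> L2_norm D \<psi> * (2 * diameter D * L2_norm D (grad \<psi>))"
    by (simp add: power2_eq_square mult_ac)
  then show ?thesis
    using L2_norm_nonneg[of D \<psi>] D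
    by (cases "L2_norm D \<psi> = 0") (auto intro: mult_nonneg_nonneg L2_norm_nonneg diameter_ge_0)
qed

text \<open>Both sides are continuous in the \<open>H\<^sup>1\<close> norm.\<close>

lemma Poincare:
  assumes D: "open D" "bounded D" and u: "u \<in> H10 D" and g: "has_weak_gradient D u g"
  shows "L2_norm D u \<le> 2 * diameter D * L2_norm D g"
proof -
  obtain \<psi> where \<psi>: "\<And>n. \<psi> n \<in> test_functions D"
    "(\<lambda>n. L2_norm D (\<lambda>x. u x - \<psi> n x)) \<longlonglongrightarrow> 0"
    "(\<lambda>n. L2_norm D (\<lambda>x. g x - grad (\<psi> n) x)) \<longlonglongrightarrow> 0"
    using H10_approximation[OF D u g] by blast
  note L2\<psi> = L2_test_function[OF \<psi>(1) D] and L2u = weak_gradient_L2[OF g]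
  have "L2_norm D u \<le> L2_norm D (\<lambda>x. u x - \<psi> n x) +
      2 * diameter D * (L2_norm D (\<lambda>x. g x - grad (\<psi> n) x) + L2_norm D g)" for n
  proof -
    have "L2_norm D u \<le> L2_norm D (\<lambda>x. u x - \<psi> n x) + L2_norm D (\<psi> n)"
      using L2_norm_triangle[OF L2_diff[OF L2u(1) L2\<psi>(1)] L2\<psi>(1), of n n] by simp
    moreover have "L2_norm D (grad (\<psi> n)) \<le> L2_norm D (\<lambda>x. g x - grad (\<psi> n) x) + L2_norm D g"
      using L2_norm_triangle[OF L2_scaleR[OF L2_diff[OF L2u(2) L2\<psi>(2)], of "-1" n] L2u(2)]
        L2_norm_scaleR[of D "-1" "\<lambda>x. g x - grad (\<psi> n) x"] by simp
    then have "2 * diameter D * L2_norm D (grad (\<psi> n)) \<le>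
        2 * diameter D * (L2_norm D (\<lambda>x. g x - grad (\<psi> n) x) + L2_norm D g)"
      using D by (intro mult_left_mono) (auto simp: diameter_ge_0)
    ultimately show ?thesis
      using Poincare_test_function[OF D \<psi>(1), of n] by linarith
  qed
  moreover have "(\<lambda>n. L2_norm D (\<lambda>x. u x - \<psi> n x) +
      2 * diameter D * (L2_norm D (\<lambda>x. g x - grad (\<psi> n) x) + L2_norm D g)) \<longlonglongrightarrow>
      0 + 2 * diameter D * (0 + L2_norm D g)"
    by (intro tendsto_intros \<psi>)
  ultimately show ?thesis
    using LIMSEQ_le_const[of _ "0 + 2 * diameter D * (0 + L2_norm D g)" "L2_norm D u"] by auto
qed

section \<open>Meshes as partitions up to null sets\<close>

text \<open>What the estimates need to know about a mesh: integrals over \<open>\<Omega>\<close> split into integrals over the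
  interiors of the elements.\<close>

definition open_partition :: "(real^'d) set \<Rightarrow> (real^'d) set set \<Rightarrow> bool" where
  "open_partition \<Omega> P \<longleftrightarrow> finite P \<and> (\<forall>D\<in>P. open D \<and> D \<subseteq> \<Omega>) \<and> disjoint P \<and> negligible (\<Omega> - \<Union>P)"

lemma simplex_interior_nonempty:
  fixes K :: "(real^'d) set"
  assumes "int CARD('d) simplex K"
  shows "interior K \<noteq> {}"
proof -
  have "aff_dim K = int DIM(real^'d)"
    using aff_dim_simplex[OF assms] by simp
  then have "rel_interior K = interior K"
    by (intro rel_interior_interior) (simp only: aff_dim_eq_full)
  moreover have "K \<noteq> {}"
    using assms by (auto simp: simplex_empty)
  ultimately show ?thesis
    using rel_interior_eq_empty[OF convex_simplex[OF assms]] by simp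
qed

text \<open>A proper face of a convex set avoids its interior. The face \<open>K \<inter> L\<close> of \<open>K\<close> meets the interior of \<open>K\<close> and is
  therefore \<open>K\<close> itself; as a face of \<open>L\<close> it has nonempty interior and is therefore also \<open>L\<close>.\<close>

lemma mesh_interior_disjoint:
  assumes mesh: "conformal_simplicial_mesh \<Omega> \<T>" and K: "K \<in> \<T>" "L \<in> \<T>" "x \<in> interior K" "x \<in> L"
  shows "K = L"
proof (rule ccontr)
  assume "K \<noteq> L"
  have faces: "(K \<inter> L) face_of K" "(L \<inter> K) face_of L"
    using mesh K unfolding conformal_simplicial_mesh_def triangulation_def by blast+
  have "x \<in> K \<inter> L \<inter> interior K" using K interior_subset by auto
  then have "K \<inter> L = K"
    using face_of_disjoint_interior[OF faces(1)] by blast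
  then have "K face_of L" "K \<subseteq> L" using faces(2) by (auto simp: Int_commute)
  then have "K \<inter> interior L = {}" using \<open>K \<noteq> L\<close> by (intro face_of_disjoint_interior) auto
  then show False
    using interior_mono[OF \<open>K \<subseteq> L\<close>] K(3) interior_subset[of K] by blast
qed

text \<open>The mesh covers the closure of \<open>\<Omega>\<close> only, so one has to exclude that an element reaches across
  the boundary, as it could at a slit. The boundary consists of faces of elements, which are proper faces
  since the boundary of an open set has no interior; such faces avoid the interiors of all elements.\<close>

lemma mesh_interior_subset:
  assumes mesh: "conformal_simplicial_mesh \<Omega> \<T>" and "open \<Omega>" "K \<in> \<T>"
  shows "interior K \<subseteq> \<Omega>"
proof
  fix x assume x: "x \<in> interior K"
  have cover: "L \<subseteq> closure \<Omega>" if "L \<in> \<T>" for L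
    using mesh that by (auto simp: conformal_simplicial_mesh_def)
  obtain \<B> where \<B>: "\<And>S. S \<in> \<B> \<Longrightarrow> \<exists>L\<in>\<T>. S face_of L" "frontier \<Omega> = \<Union>\<B>"
    using mesh unfolding conformal_simplicial_mesh_def by blast
  show "x \<in> \<Omega>"
  proof (rule ccontr)
    assume "x \<notin> \<Omega>"
    then have "x \<in> frontier \<Omega>"
      using x cover[OF assms(3)] interior_subset assms(2) by (auto simp: frontier_def interior_open)
    then obtain S L where S: "S \<in> \<B>" "x \<in> S" "L \<in> \<T>" "S face_of L"
      using \<B> by blast
    have "S \<noteq> L"
    proof
      assume "S = L"
      then have sub: "interior L \<subseteq> frontier \<Omega>" using S(1) \<B>(2) interior_subset by blast
      then have "interior L \<inter> \<Omega> = {}"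
        using assms(2) by (auto simp: frontier_def interior_open)
      then have "interior L \<inter> closure \<Omega> = {}"
        using open_Int_closure_eq_empty[OF open_interior] by blast
      then have "interior L = {}" using sub by (auto simp: frontier_def)
      then show False
        using simplex_interior_nonempty mesh S(3) by (auto simp: conformal_simplicial_mesh_def)
    qed
    moreover have "K = L"
      using mesh assms(3) S(3) x by (rule mesh_interior_disjoint) (use face_of_imp_subset[OF S(4)] S(2) in auto)
    ultimately show False
      using face_of_disjoint_interior[OF S(4)] x S(2) by blast
  qed
qed

lemma mesh_open_partition:
  assumes mesh: "conformal_simplicial_mesh \<Omega> \<T>" and "open \<Omega>"
  shows "open_partition \<Omega> (interior ` \<T>)"
  unfolding open_partition_def
proof (intro conjI ballI)
  have T: "triangulation \<T>" "\<And>K. K \<in> \<T> \<Longrightarrow> int CARD('a) simplex K" "\<Union>\<T> = closure \<Omega>"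
    using mesh by (auto simp: conformal_simplicial_mesh_def)
  show fin: "finite (interior ` \<T>)" using T(1) by (simp add: triangulation_def)
  show "open D" "D \<subseteq> \<Omega>" if "D \<in> interior ` \<T>" for D
    using that mesh_interior_subset[OF assms] by auto
  show "disjoint (interior ` \<T>)"
    unfolding disjoint_def
  proof (intro ballI impI)
    fix D E assume "D \<in> interior ` \<T>" "E \<in> interior ` \<T>" "D \<noteq> E"
    then show "D \<inter> E = {}"
      using mesh_interior_disjoint[OF mesh] interior_subset by fast
  qed
  have "\<Omega> - \<Union>(interior ` \<T>) \<subseteq> \<Union>(frontier ` \<T>)"
  proof
    fix x assume x: "x \<in> \<Omega> - \<Union>(interior ` \<T>)"
    then obtain K where "K \<in> \<T>" "x \<in> K" using T(3) closure_subset by blast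
    then show "x \<in> \<Union>(frontier ` \<T>)"
      using x closure_subset[of K] by (auto simp: frontier_def)
  qed
  moreover have "negligible (\<Union>(frontier ` \<T>))"
    using T(1,2) by (intro negligible_Union) (auto simp: triangulation_def intro: negligible_convex_frontier convex_simplex)
  ultimately show "negligible (\<Omega> - \<Union>(interior ` \<T>))"
    by (rule negligible_subset[rotated])
qed

lemma integral_open_partition:
  fixes h :: "real^'d \<Rightarrow> real"
  assumes P: "open_partition \<Omega> P" and "open \<Omega>" and h: "integrable (lebesgue_on \<Omega>) h"
  shows "(LINT x|lebesgue_on \<Omega>. h x) = (\<Sum>D\<in>P. LINT x|lebesgue_on D. h x)"
proof -
  have Pf: "finite P" "\<And>D. D \<in> P \<Longrightarrow> open D" "\<And>D. D \<in> P \<Longrightarrow> D \<subseteq> \<Omega>" "disjoint P" "negligible (\<Omega> - \<Union>P)"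
    using P by (auto simp: open_partition_def)
  have h\<Omega>: "set_integrable lebesgue \<Omega> h"
    using h assms(2) by (simp add: integrable_restrict_space set_integrable_def)
  have hD: "set_integrable lebesgue D h" if "D \<in> sets lebesgue" "D \<subseteq> \<Omega>" for D
    using h\<Omega> that by (rule set_integrable_subset)
  have UP: "\<Union>P \<in> sets lebesgue" "\<Union>P \<subseteq> \<Omega>" using Pf by auto
  have "(LINT x|lebesgue_on \<Omega>. h x) = (LINT x|lebesgue. indicator \<Omega> x *\<^sub>R h x)"
    using assms(2) by (simp add: integral_restrict_space)
  also have "\<dots> = (LINT x|lebesgue. indicator (\<Union>P) x *\<^sub>R h x)"
  proof (rule integral_cong_AE)
    show "AE x in lebesgue. indicator \<Omega> x *\<^sub>R h x = indicator (\<Union>P) x *\<^sub>R h x"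
      by (rule AE_I'[of "\<Omega> - \<Union>P"])
         (use Pf(5) UP(2) in \<open>auto simp: negligible_iff_null_sets indicator_def split: if_splits\<close>)
  qed (use h\<Omega> hD[OF UP] in \<open>auto simp: set_integrable_def\<close>)
  also have "\<dots> = (LINT x|lebesgue. (\<Sum>D\<in>P. indicator D x *\<^sub>R h x))"
  proof (intro Bochner_Integration.integral_cong refl)
    fix x
    show "indicator (\<Union>P) x *\<^sub>R h x = (\<Sum>D\<in>P. indicator D x *\<^sub>R h x)"
    proof (cases "x \<in> \<Union>P")
      case True
      then obtain D where D: "D \<in> P" "x \<in> D" by blast
      then have "x \<notin> E" if "E \<in> P - {D}" for E
        using that Pf(4) by (auto simp: disjoint_def)
      then show ?thesis
        using D Pf(1) True by (simp add: sum.remove[OF Pf(1) D(1)])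
    qed auto
  qed
  also have "\<dots> = (\<Sum>D\<in>P. LINT x|lebesgue. indicator D x *\<^sub>R h x)"
    using hD Pf(2,3) by (intro Bochner_Integration.integral_sum) (auto simp: set_integrable_def)
  also have "\<dots> = (\<Sum>D\<in>P. LINT x|lebesgue_on D. h x)"
    using Pf(2) by (intro sum.cong refl) (simp add: integral_restrict_space)
  finally show ?thesis .
qed

lemma L2_norm_open_partition:
  fixes h :: "real^'d \<Rightarrow> 'b::euclidean_space"
  assumes "open_partition \<Omega> P" "open \<Omega>" "h \<in> L2 \<Omega>"
  shows "(L2_norm \<Omega> h)\<^sup>2 = (\<Sum>D\<in>P. (L2_norm D h)\<^sup>2)"
  unfolding L2_norm_square
  by (rule integral_open_partition[OF assms(1,2) L2_square_integrable[OF assms(3)]])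

lemma L2_extend_by_0:
  fixes h :: "real^'d \<Rightarrow> 'b::euclidean_space"
  assumes "open D" "open \<Omega>" "D \<subseteq> \<Omega>" "h \<in> L2 D"
  shows "(\<lambda>x. indicator D x *\<^sub>R h x) \<in> L2 \<Omega>"
proof -
  have m: "(\<lambda>x. indicator D x *\<^sub>R h x) \<in> borel_measurable lebesgue"
    using L2_measurable[OF assms(4)] assms(1)
    by (simp add: borel_measurable_restrict_space_iff)
  have "integrable lebesgue (\<lambda>x. indicator D x *\<^sub>R (norm (h x))\<^sup>2)"
    using L2_square_integrable[OF assms(4)] assms(1) by (simp add: integrable_restrict_space)
  moreover have "(\<lambda>x. indicator D x *\<^sub>R (norm (h x))\<^sup>2) =
      (\<lambda>x. indicator \<Omega> x *\<^sub>R (norm (indicator D x *\<^sub>R h x))\<^sup>2)"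
    using assms(3) by (auto simp: fun_eq_iff indicator_def)
  ultimately have "integrable (lebesgue_on \<Omega>) (\<lambda>x. (norm (indicator D x *\<^sub>R h x))\<^sup>2)"
    using assms(2) by (simp add: integrable_restrict_space)
  then show ?thesis
    using measurable_restrict_space1[OF m] by (simp add: L2_def)
qed

lemma L2_sum:
  fixes h :: "'i \<Rightarrow> real^'d \<Rightarrow> 'b::euclidean_space"
  assumes "\<And>i. i \<in> I \<Longrightarrow> h i \<in> L2 D"
  shows "(\<lambda>x. \<Sum>i\<in>I. h i x) \<in> L2 D"
proof -
  have "(\<lambda>x. 0::'b) \<in> L2 D" by (simp add: L2_def)
  with assms show ?thesis
    by (induction I rule: infinite_finite_induct) (simp_all add: L2_add)
qed

text \<open>Zero boundary values on every piece: no jumps arise across the interfaces, since Green's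
  formula on each piece has no boundary term.\<close>

lemma weak_gradient_glue:
  fixes w :: "real^'d \<Rightarrow> real"
  assumes \<Omega>: "open \<Omega>" "bounded \<Omega>" and P: "open_partition \<Omega> P" and w: "w \<in> L2 \<Omega>"
    and H10: "\<And>D. D \<in> P \<Longrightarrow> w \<in> H10 D"
  obtains g where "has_weak_gradient \<Omega> w g"
proof
  have Pf: "finite P" "\<And>D. D \<in> P \<Longrightarrow> open D" "\<And>D. D \<in> P \<Longrightarrow> D \<subseteq> \<Omega>" "disjoint P"
    using P by (auto simp: open_partition_def)
  have bd: "bounded D" if "D \<in> P" for D
    using \<Omega>(2) Pf(3)[OF that] by (rule bounded_subset)
  have wg: "has_weak_gradient D w (weak_gradient D w)" if "D \<in> P" for D
    by (intro has_weak_gradient_weak_gradient H10_imp_H1 H10 that)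
  \<comment> \<open>At most one summand is nonzero.\<close>
  define g where "g x = (\<Sum>D\<in>P. indicator D x *\<^sub>R weak_gradient D w x)" for x
  have g_on: "g x = weak_gradient D w x" if "D \<in> P" "x \<in> D" for D x
  proof -
    have "x \<notin> E" if "E \<in> P - {D}" for E
      using that \<open>D \<in> P\<close> \<open>x \<in> D\<close> Pf(4) by (auto simp: disjoint_def)
    then show ?thesis
      using that by (simp add: g_def sum.remove[OF Pf(1) that(1)])
  qed
  have g: "g \<in> L2 \<Omega>"
    unfolding g_def[abs_def]
    by (intro L2_sum L2_extend_by_0 Pf \<Omega> weak_gradient_L2(2)[OF wg])
  show "has_weak_gradient \<Omega> w g"
    unfolding has_weak_gradient_def
  proof (intro conjI ballI allI w g)
    fix \<psi> :: "real^'d \<Rightarrow> real" and i assume \<psi>: "\<psi> \<in> test_functions \<Omega>"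
    note L2\<psi> = L2_test_function[OF \<psi> \<Omega>]
    have "(LINT x|lebesgue_on \<Omega>. w x * partial_deriv i \<psi> x) =
        (\<Sum>D\<in>P. LINT x|lebesgue_on D. w x * partial_deriv i \<psi> x)"
      by (rule integral_open_partition[OF P \<Omega>(1) L2_mult_integrable[OF w L2\<psi>(3)]])
    also have "\<dots> = (\<Sum>D\<in>P. - (LINT x|lebesgue_on D. g x $ i * \<psi> x))"
    proof (intro sum.cong refl)
      fix D assume D: "D \<in> P"
      have "(LINT x|lebesgue_on D. w x * partial_deriv i \<psi> x) =
          - (LINT x|lebesgue_on D. weak_gradient D w x $ i * \<psi> x)"
        by (rule H10_Green[OF Pf(2)[OF D] bd[OF D] H10[OF D] wg[OF D] test_function_C1[OF \<psi>]])
      also have "(LINT x|lebesgue_on D. weak_gradient D w x $ i * \<psi> x) = (LINT x|lebesgue_on D. g x $ i * \<psi> x)"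
        by (rule Bochner_Integration.integral_cong) (simp_all add: g_on[OF D])
      finally show "(LINT x|lebesgue_on D. w x * partial_deriv i \<psi> x) = - (LINT x|lebesgue_on D. g x $ i * \<psi> x)" .
    qed
    also have "\<dots> = - (LINT x|lebesgue_on \<Omega>. g x $ i * \<psi> x)"
      using integral_open_partition[OF P \<Omega>(1) L2_mult_integrable[OF L2_component[OF g] L2\<psi>(1)], of i]
      by (simp add: sum_negf)
    finally show "(LINT x|lebesgue_on \<Omega>. w x * partial_deriv i \<psi> x) = - (LINT x|lebesgue_on \<Omega>. g x $ i * \<psi> x)" .
  qed
qed

section \<open>The bilinear form\<close>

text \<open>The exceptional null set may depend on the two vectors. It suffices to let them range over a countable
  dense set, because the inequalities are preserved under limits.\<close>

lemma elliptic_AE: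
  assumes "elliptic_coeff \<Omega> m M A"
  shows "AE x in lebesgue_on \<Omega>. \<forall>\<xi> \<eta>. m * (norm \<xi>)\<^sup>2 \<le> \<xi> \<bullet> (A x *v \<xi>) \<and> \<bar>\<eta> \<bullet> (A x *v \<xi>)\<bar> \<le> M * norm \<xi> * norm \<eta>"
proof -
  obtain Q :: "(real^'a) set" where Q: "countable Q" "\<And>X. open X \<Longrightarrow> X \<noteq> {} \<Longrightarrow> \<exists>q\<in>Q. q \<in> X"
    using countable_dense_exists by blast
  have dense: "C = UNIV" if "closed C" "Q \<subseteq> C" for C
    using Q(2)[of "- C"] that by blast
  have "AE x in lebesgue_on \<Omega>. \<forall>\<xi>\<in>Q. \<forall>\<eta>\<in>Q.
      m * (norm \<xi>)\<^sup>2 \<le> \<xi> \<bullet> (A x *v \<xi>) \<and> \<bar>\<eta> \<bullet> (A x *v \<xi>)\<bar> \<le> M * norm \<xi> * norm \<eta>"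
    using assms by (simp add: AE_ball_countable[OF Q(1)] elliptic_coeff_def)
  then show ?thesis
  proof eventually_elim
    case (elim x)
    have cont: "continuous_on UNIV (\<lambda>\<xi>. A x *v \<xi>)"
      by (intro linear_continuous_on matrix_vector_mul_bounded_linear)
    obtain q where "q \<in> Q" using Q(2)[of UNIV] by auto
    have "closed {\<xi>. m * (norm \<xi>)\<^sup>2 \<le> \<xi> \<bullet> (A x *v \<xi>)}"
      by (intro closed_Collect_le continuous_intros cont)
    then have 1: "{\<xi>. m * (norm \<xi>)\<^sup>2 \<le> \<xi> \<bullet> (A x *v \<xi>)} = UNIV"
      by (rule dense) (use elim \<open>q \<in> Q\<close> in blast)
    have 2: "{\<xi>. \<bar>\<eta> \<bullet> (A x *v \<xi>)\<bar> \<le> M * norm \<xi> * norm \<eta>} = UNIV" if "\<eta> \<in> Q" for \<eta>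
    proof (rule dense)
      show "closed {\<xi>. \<bar>\<eta> \<bullet> (A x *v \<xi>)\<bar> \<le> M * norm \<xi> * norm \<eta>}"
        by (intro closed_Collect_le continuous_intros cont)
    qed (use elim that in blast)
    have 3: "{\<eta>. \<bar>\<eta> \<bullet> (A x *v \<xi>)\<bar> \<le> M * norm \<xi> * norm \<eta>} = UNIV" for \<xi>
    proof (rule dense)
      show "closed {\<eta>. \<bar>\<eta> \<bullet> (A x *v \<xi>)\<bar> \<le> M * norm \<xi> * norm \<eta>}"
        by (intro closed_Collect_le continuous_intros)
    qed (use 2 in blast)
    show ?case using 1 3 by blast
  qed
qed

lemma elliptic_mult_L2:
  fixes A :: "real^'d \<Rightarrow> real^'d^'d"
  assumes "elliptic_coeff \<Omega> m M A" "g \<in> L2 \<Omega>"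
  shows "(\<lambda>x. A x *v g x) \<in> L2 \<Omega>"
proof (rule L2_dominated)
  show "(\<lambda>x. A x *v g x) \<in> borel_measurable (lebesgue_on \<Omega>)"
    using _ L2_measurable[OF assms(2)]
    by (rule borel_measurable_matrix_vector_mult) (use assms(1) in \<open>simp add: elliptic_coeff_def\<close>)
  show "integrable (lebesgue_on \<Omega>) (\<lambda>x. M\<^sup>2 * (norm (g x))\<^sup>2)"
    by (intro integrable_mult_right L2_square_integrable assms)
  show "AE x in lebesgue_on \<Omega>. (norm (A x *v g x))\<^sup>2 \<le> M\<^sup>2 * (norm (g x))\<^sup>2"
    using elliptic_AE[OF assms(1)]
  proof eventually_elim
    case (elim x)
    let ?v = "A x *v g x"
    \<comment> \<open>The bound on the form, tested with \<open>\<eta> = A \<xi>\<close>.\<close>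
    have "norm ?v * norm ?v \<le> M * norm (g x) * norm ?v"
      using elim[rule_format, of "g x" ?v] by (simp add: dot_square_norm power2_eq_square)
    moreover have "0 \<le> M * norm (g x)"
    proof -
      \<comment> \<open>The sign of \<open>M\<close> follows from the bound on the form with any nonzero \<open>\<eta>\<close>.\<close>
      have "0 \<le> M * norm (g x) * norm (axis undefined 1 :: real^'d)"
        using elim[rule_format, of "g x" "axis undefined 1"] by linarith
      then show ?thesis by simp
    qed
    ultimately have "norm ?v \<le> M * norm (g x)"
      using mult_le_cancel_right[of "norm ?v" "norm ?v" "M * norm (g x)"] by (cases "?v = 0") simp_all
    then have "(norm ?v)\<^sup>2 \<le> (M * norm (g x))\<^sup>2" by (intro power_mono) auto
    then show ?case by (simp add: power_mult_distrib)
  qed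
qed

lemma elliptic_subset:
  assumes "elliptic_coeff \<Omega> m M A" "open D" "open \<Omega>" "D \<subseteq> \<Omega>"
  shows "elliptic_coeff D m M A"
  unfolding elliptic_coeff_def
proof (intro conjI allI)
  show "A \<in> borel_measurable (lebesgue_on D)"
    using assms(1,4) by (auto simp: elliptic_coeff_def intro: measurable_restrict_mono)
  fix \<xi> \<eta>
  show "AE x in lebesgue_on D. m * (norm \<xi>)\<^sup>2 \<le> \<xi> \<bullet> (A x *v \<xi>) \<and> \<bar>\<eta> \<bullet> (A x *v \<xi>)\<bar> \<le> M * norm \<xi> * norm \<eta>"
    by (rule AE_lebesgue_on_subset[where E = \<Omega>]) (use assms in \<open>auto simp: elliptic_coeff_def\<close>)
qed

lemma coercive:
  assumes "elliptic_coeff \<Omega> m M A" "g \<in> L2 \<Omega>"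
  shows "m * (L2_norm \<Omega> g)\<^sup>2 \<le> (LINT x|lebesgue_on \<Omega>. g x \<bullet> (A x *v g x))"
proof -
  have "(LINT x|lebesgue_on \<Omega>. m * (norm (g x))\<^sup>2) \<le> (LINT x|lebesgue_on \<Omega>. g x \<bullet> (A x *v g x))"
  proof (rule integral_mono_AE)
    show "AE x in lebesgue_on \<Omega>. m * (norm (g x))\<^sup>2 \<le> g x \<bullet> (A x *v g x)"
      using elliptic_AE[OF assms(1)] by eventually_elim blast
  qed (intro integrable_mult_right L2_square_integrable L2_inner_integrable elliptic_mult_L2[OF assms(1)] assms(2))+
  then show ?thesis by (simp add: L2_norm_square)
qed

lemma a_form_sum_eq_0:
  fixes D :: "(real^'d) set"
  assumes D: "open D" "bounded D" and A: "elliptic_coeff D m M A" and w: "w \<in> H1 D"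
    and u: "\<And>i. i \<in> I \<Longrightarrow> u i \<in> H1 D" "\<And>i. i \<in> I \<Longrightarrow> a_form A D (u i) w = 0"
  shows "a_form A D (\<lambda>x. \<Sum>i\<in>I. c i * u i x) w = 0"
proof -
  have Am: "A \<in> borel_measurable (lebesgue_on D)" using A by (simp add: elliptic_coeff_def)
  obtain h where h: "has_weak_gradient D w h" using w by (auto simp: H1_def)
  define g where "g i = weak_gradient D (u i)" for i
  have g: "has_weak_gradient D (u i) (g i)" if "i \<in> I" for i
    unfolding g_def by (rule has_weak_gradient_weak_gradient[OF u(1)[OF that]])
  have wg0: "has_weak_gradient D (\<lambda>x. 0) (\<lambda>x. 0)"
    by (simp add: has_weak_gradient_def L2_def)
  have wg: "has_weak_gradient D (\<lambda>x. \<Sum>i\<in>I. c i * u i x) (\<lambda>x. \<Sum>i\<in>I. c i *\<^sub>R g i x)"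
    using g by (induction I rule: infinite_finite_induct)
      (simp_all add: wg0 has_weak_gradient_add[OF D] has_weak_gradient_cmult)
  have int: "integrable (lebesgue_on D) (\<lambda>x. h x \<bullet> (A x *v g i x))" if "i \<in> I" for i
    by (intro L2_inner_integrable elliptic_mult_L2[OF A] weak_gradient_L2(2)[OF h] weak_gradient_L2(2)[OF g[OF that]])
  have "a_form A D (\<lambda>x. \<Sum>i\<in>I. c i * u i x) w = (LINT x|lebesgue_on D. (\<Sum>i\<in>I. c i * (h x \<bullet> (A x *v g i x))))"
    unfolding a_form_eq[OF D Am wg h]
    by (simp add: inner_sum_right linear_sum[OF matrix_vector_mul_linear] matrix_vector_mult_scaleR)
  also have "\<dots> = (\<Sum>i\<in>I. c i * (LINT x|lebesgue_on D. h x \<bullet> (A x *v g i x)))"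
    using int by (subst Bochner_Integration.integral_sum) simp_all
  also have "\<dots> = 0"
    using u(2) g by (intro sum.neutral) (simp add: a_form_eq[OF D Am g h, symmetric])
  finally show ?thesis .
qed

section \<open>Comparison of a function with its piecewise affine interpolant\<close>

lemma has_weak_gradient_cong:
  assumes "has_weak_gradient D u g" "\<And>x. x \<in> D \<Longrightarrow> u x = v x"
  shows "has_weak_gradient D v g"
proof -
  have "u \<in> L2 D \<longleftrightarrow> v \<in> L2 D"
    unfolding L2_def mem_Collect_eq
    by (intro conj_cong measurable_cong Bochner_Integration.integrable_cong) (simp_all add: assms(2))
  moreover have "(LINT x|lebesgue_on D. u x * p x) = (LINT x|lebesgue_on D. v x * p x)" for p
    by (rule Bochner_Integration.integral_cong) (simp_all add: assms(2))
  ultimately show ?thesis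
    using assms(1) by (simp add: has_weak_gradient_def)
qed

text \<open>Here \<open>\<nabla>w = G - a\<close> has mean zero, so \<open>\<parallel>\<nabla>w\<parallel>\<^sup>2 = \<integral> \<nabla>w \<bullet> (G - a) = \<integral> \<nabla>w \<bullet> G\<close>, and \<open>\<parallel>\<nabla>w\<parallel> \<le> \<parallel>G\<parallel>\<close> by the Cauchy-Schwarz
  inequality. The Poincare inequality turns this into a bound on \<open>w\<close>.\<close>

lemma remainder_bound_piece:
  fixes D :: "(real^'d) set"
  assumes D: "open D" "bounded D" and e: "has_weak_gradient D e G"
    and aff: "\<And>x. x \<in> D \<Longrightarrow> e x - w x = a \<bullet> x + b"
    and w: "w \<in> H10 D"
  shows "L2_norm D w \<le> 2 * diameter D * L2_norm D G"
proof -
  have affC1: "C1 (\<lambda>x. a \<bullet> x + b)" and gr: "grad (\<lambda>x. a \<bullet> x + b) = (\<lambda>x. a)"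
    by (rule C1_affine) (simp add: fun_eq_iff vec_eq_iff grad_component partial_deriv_affine)
  have "has_weak_gradient D (\<lambda>x. e x - (a \<bullet> x + b)) (\<lambda>x. G x - a)"
    using has_weak_gradient_diff[OF D e C1_weak_gradient[OF D affC1]] unfolding gr .
  then have g: "has_weak_gradient D w (\<lambda>x. G x - a)"
    by (rule has_weak_gradient_cong) (use aff in \<open>fastforce simp: algebra_simps\<close>)
  let ?g = "\<lambda>x. G x - a"
  note L2 = weak_gradient_L2(2)[OF g] weak_gradient_L2(2)[OF e]
  have ca: "(\<lambda>x. a) \<in> L2 D" by (intro L2_continuous D continuous_on_const)
  have "(L2_norm D ?g)\<^sup>2 = (LINT x|lebesgue_on D. ?g x \<bullet> G x - ?g x \<bullet> a)"
    unfolding L2_norm_square by (simp add: power2_norm_eq_inner inner_diff_right)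
  also have "\<dots> = (LINT x|lebesgue_on D. ?g x \<bullet> G x) - (LINT x|lebesgue_on D. ?g x \<bullet> a)"
    by (intro Bochner_Integration.integral_diff L2_inner_integrable L2 ca)
  also have "\<dots> \<le> L2_norm D ?g * L2_norm D G"
    using L2_Cauchy_Schwarz[OF L2] H10_mean_gradient_0[OF D w g, of a] by simp
  finally have "L2_norm D ?g * L2_norm D ?g \<le> L2_norm D ?g * L2_norm D G"
    by (simp add: power2_eq_square)
  then have "L2_norm D ?g \<le> L2_norm D G"
    using L2_norm_nonneg[of D ?g] L2_norm_nonneg[of D G] by (cases "L2_norm D ?g = 0") auto
  then have "2 * diameter D * L2_norm D ?g \<le> 2 * diameter D * L2_norm D G"
    using D by (intro mult_left_mono) (auto simp: diameter_ge_0)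
  then show ?thesis
    using Poincare[OF D w g] by linarith
qed

lemma remainder_bound:
  fixes \<Omega> :: "(real^'d) set"
  assumes \<Omega>: "open \<Omega>" "bounded \<Omega>" and P: "open_partition \<Omega> P"
    and diam: "\<And>D. D \<in> P \<Longrightarrow> diameter D \<le> H" and "0 \<le> H"
    and e: "has_weak_gradient \<Omega> e G" and w: "w \<in> L2 \<Omega>"
    and aff: "\<And>D. D \<in> P \<Longrightarrow> \<exists>a b. \<forall>x\<in>D. e x - w x = a \<bullet> x + b"
    and H10: "\<And>D. D \<in> P \<Longrightarrow> w \<in> H10 D"
  shows "L2_norm \<Omega> w \<le> 2 * H * L2_norm \<Omega> G"
proof (rule power2_le_imp_le)
  have "(L2_norm D w)\<^sup>2 \<le> (2 * H)\<^sup>2 * (L2_norm D G)\<^sup>2" if D: "D \<in> P" for D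
  proof -
    have D': "open D" "D \<subseteq> \<Omega>" using P D by (auto simp: open_partition_def)
    then have b: "bounded D" using \<Omega>(2) bounded_subset by blast
    obtain a b where ab: "\<forall>x\<in>D. e x - w x = a \<bullet> x + b" using aff[OF D] by blast
    have "L2_norm D w \<le> 2 * diameter D * L2_norm D G"
      using remainder_bound_piece[OF D'(1) b has_weak_gradient_subset[OF D'(1) \<Omega>(1) D'(2) e] _ H10[OF D]] ab
      by blast
    also have "\<dots> \<le> 2 * H * L2_norm D G"
      using diam[OF D] by (intro mult_right_mono L2_norm_nonneg) simp
    finally have "(L2_norm D w)\<^sup>2 \<le> (2 * H * L2_norm D G)\<^sup>2"
      by (intro power_mono L2_norm_nonneg)
    then show ?thesis by (simp add: power_mult_distrib)
  qed
  then have "(\<Sum>D\<in>P. (L2_norm D w)\<^sup>2) \<le> (2 * H)\<^sup>2 * (\<Sum>D\<in>P. (L2_norm D G)\<^sup>2)"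
    by (simp add: sum_distrib_left sum_mono)
  then show "(L2_norm \<Omega> w)\<^sup>2 \<le> (2 * H * L2_norm \<Omega> G)\<^sup>2"
    unfolding power_mult_distrib[of "2 * H"]
    by (simp add: L2_norm_open_partition[OF P \<Omega>(1)] w weak_gradient_L2[OF e])
qed (use assms(5) in \<open>simp add: L2_norm_nonneg\<close>)

section \<open>Difference of the Galerkin and Petrov-Galerkin solutions\<close>

lemma P1_space_sum:
  assumes "\<And>i. i \<in> I \<Longrightarrow> v i \<in> P1_space \<Omega> \<T>"
  shows "(\<lambda>x. \<Sum>i\<in>I. c i * v i x) \<in> P1_space \<Omega> \<T>"
  unfolding P1_space_def mem_Collect_eq
proof (intro conjI ballI)
  show "continuous_on (closure \<Omega>) (\<lambda>x. \<Sum>i\<in>I. c i * v i x)"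
    using assms by (intro continuous_intros) (auto simp: P1_space_def)
  show "(\<Sum>i\<in>I. c i * v i x) = 0" if "x \<in> frontier \<Omega>" for x
    using assms that by (intro sum.neutral) (auto simp: P1_space_def)
  fix K assume "K \<in> \<T>"
  then have "\<forall>i\<in>I. \<exists>a b. \<forall>x\<in>K. v i x = a \<bullet> x + b"
    using assms by (auto simp: P1_space_def)
  then obtain a b where ab: "\<And>i x. i \<in> I \<Longrightarrow> x \<in> K \<Longrightarrow> v i x = a i \<bullet> x + b i"
    by metis
  show "\<exists>a b. \<forall>x\<in>K. (\<Sum>i\<in>I. c i * v i x) = a \<bullet> x + b"
  proof (intro exI ballI)
    fix x assume "x \<in> K"
    then show "(\<Sum>i\<in>I. c i * v i x) = (\<Sum>i\<in>I. c i *\<^sub>R a i) \<bullet> x + (\<Sum>i\<in>I. c i * b i)"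
      by (simp add: ab distrib_left sum.distrib inner_sum_left)
  qed
qed

lemma P1_space_L2:
  assumes "open \<Omega>" "bounded \<Omega>" "v \<in> P1_space \<Omega> \<T>"
  shows "v \<in> L2 \<Omega>"
proof -
  have cont: "continuous_on (closure \<Omega>) v"
    using assms(3) by (simp add: P1_space_def)
  have "bounded (v ` closure \<Omega>)"
    using cont assms(2) by (intro compact_imp_bounded compact_continuous_image) auto
  then obtain B where "\<forall>y\<in>v ` closure \<Omega>. norm y \<le> B"
    unfolding bounded_iff by blast
  then have B: "norm (v x) \<le> B" if "x \<in> \<Omega>" for x
    using that closure_subset by blast
  have "v \<in> borel_measurable (lebesgue_on \<Omega>)"
    using assms(1) continuous_on_subset[OF cont closure_subset]
    by (intro continuous_imp_measurable_on_sets_lebesgue) auto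
  then show ?thesis
    using lmeasurable_open[OF assms(2,1)] B by (rule L2_bounded)
qed

lemma mesh_diameter:
  assumes mesh: "conformal_simplicial_mesh \<Omega> \<T>"
  shows "D \<in> interior ` \<T> \<Longrightarrow> diameter D \<le> mesh_size \<T>"
    and "\<Omega> \<noteq> {} \<Longrightarrow> 0 \<le> mesh_size \<T>"
proof -
  have T: "finite \<T>" "\<And>K. K \<in> \<T> \<Longrightarrow> bounded K" "\<Union>\<T> = closure \<Omega>"
  proof -
    fix K assume "K \<in> \<T>"
    then have "int CARD('a) simplex K" using mesh by (simp add: conformal_simplicial_mesh_def)
    then show "bounded K" by (intro compact_imp_bounded compact_simplex)
  qed (use mesh in \<open>simp_all add: conformal_simplicial_mesh_def triangulation_def\<close>)
  have le: "diameter K \<le> mesh_size \<T>" if "K \<in> \<T>" for K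
    unfolding mesh_size_def using T(1) that by (intro Max_ge) auto
  show "diameter D \<le> mesh_size \<T>" if "D \<in> interior ` \<T>"
  proof -
    from that obtain K where K: "K \<in> \<T>" "D = interior K" by blast
    then have "diameter D \<le> diameter K"
      using T(2) by (intro diameter_subset) (auto simp: interior_subset)
    with le[OF K(1)] show ?thesis by linarith
  qed
  show "0 \<le> mesh_size \<T>" if "\<Omega> \<noteq> {}"
  proof -
    from that have "\<Union>\<T> \<noteq> {}" using T(3) by simp
    then obtain K where K: "K \<in> \<T>" by blast
    then show ?thesis
      using le[OF K] diameter_ge_0[OF T(2)[OF K]] by linarith
  qed
qed

text \<open>The error identity \<open>a(e, e) = F(w)\<close> for \<open>e = u1 - u2\<close>, combined with coercivity and the bound on \<open>w\<close>. The
  equations \<open>eq1\<close> and \<open>eq2\<close> are the two discrete problems tested with \<open>e\<close> and \<open>e - w\<close>, and \<open>eq3\<close> makes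
  \<open>a(u2, w)\<close> vanish element by element.\<close>

lemma Galerkin_Petrov_Galerkin_gradient_bound:
  fixes \<Omega> :: "(real^'d) set"
  assumes \<Omega>: "open \<Omega>" "bounded \<Omega>" and m: "0 < m" and A: "elliptic_coeff \<Omega> m M A" and f: "f \<in> L2 \<Omega>"
    and P: "open_partition \<Omega> P" and diam: "\<And>D. D \<in> P \<Longrightarrow> diameter D \<le> H" and H: "0 \<le> H"
    and u: "has_weak_gradient \<Omega> u1 U1" "has_weak_gradient \<Omega> u2 U2"
    and w: "w \<in> L2 \<Omega>"
    and aff: "\<And>D. D \<in> P \<Longrightarrow> \<exists>a b. \<forall>x\<in>D. (u1 x - u2 x) - w x = a \<bullet> x + b"
    and H10: "\<And>D. D \<in> P \<Longrightarrow> w \<in> H10 D"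
    and eq1: "a_form A \<Omega> u1 (\<lambda>x. u1 x - u2 x) = F_form f \<Omega> (\<lambda>x. u1 x - u2 x)"
    and eq2: "a_form A \<Omega> u2 (\<lambda>x. (u1 x - u2 x) - w x) = F_form f \<Omega> (\<lambda>x. (u1 x - u2 x) - w x)"
    and eq3: "\<And>D. D \<in> P \<Longrightarrow> a_form A D u2 w = 0"
  shows "m * L2_norm \<Omega> (\<lambda>x. U1 x - U2 x) \<le> 2 * H * L2_norm \<Omega> f"
proof -
  let ?e = "\<lambda>x. u1 x - u2 x" and ?G = "\<lambda>x. U1 x - U2 x"
  have Am: "A \<in> borel_measurable (lebesgue_on \<Omega>)" using A by (simp add: elliptic_coeff_def)
  have e: "has_weak_gradient \<Omega> ?e ?G" by (rule has_weak_gradient_diff[OF \<Omega> u])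
  obtain g where g: "has_weak_gradient \<Omega> w g"
    using weak_gradient_glue[OF \<Omega> P w H10] by blast
  have e1: "has_weak_gradient \<Omega> (\<lambda>x. ?e x - w x) (\<lambda>x. ?G x - g x)"
    by (rule has_weak_gradient_diff[OF \<Omega> e g])
  note L2 = weak_gradient_L2[OF e] weak_gradient_L2[OF g] weak_gradient_L2[OF u(1)] weak_gradient_L2[OF u(2)]
  have int: "integrable (lebesgue_on \<Omega>) (\<lambda>x. p x \<bullet> (A x *v q x))" if "p \<in> L2 \<Omega>" "q \<in> L2 \<Omega>" for p q
    by (intro L2_inner_integrable elliptic_mult_L2[OF A] that)
  have orth: "(LINT x|lebesgue_on \<Omega>. g x \<bullet> (A x *v U2 x)) = 0"
  proof -
    have "(LINT x|lebesgue_on \<Omega>. g x \<bullet> (A x *v U2 x)) = (\<Sum>D\<in>P. LINT x|lebesgue_on D. g x \<bullet> (A x *v U2 x))"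
      by (intro integral_open_partition[OF P \<Omega>(1)] int L2)
    also have "\<dots> = 0"
    proof (intro sum.neutral ballI)
      fix D assume D: "D \<in> P"
      have D': "open D" "D \<subseteq> \<Omega>" using P D by (auto simp: open_partition_def)
      then have b: "bounded D" using \<Omega>(2) bounded_subset by blast
      have "A \<in> borel_measurable (lebesgue_on D)"
        using Am D'(2) by (rule measurable_restrict_mono)
      from a_form_eq[OF D'(1) b this has_weak_gradient_subset[OF D'(1) \<Omega>(1) D'(2) u(2)]
          has_weak_gradient_subset[OF D'(1) \<Omega>(1) D'(2) g]]
      show "(LINT x|lebesgue_on D. g x \<bullet> (A x *v U2 x)) = 0"
        using eq3[OF D] by simp
    qed
    finally show ?thesis .
  qed
  have "m * (L2_norm \<Omega> ?G)\<^sup>2 \<le> (LINT x|lebesgue_on \<Omega>. ?G x \<bullet> (A x *v ?G x))"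
    by (rule coercive[OF A L2(2)])
  also have "\<dots> = (LINT x|lebesgue_on \<Omega>. ?G x \<bullet> (A x *v U1 x) -
      ((?G x - g x) \<bullet> (A x *v U2 x) + g x \<bullet> (A x *v U2 x)))"
    by (simp add: matrix_vector_mult_diff_distrib inner_diff_left inner_diff_right)
  also have "\<dots> = (LINT x|lebesgue_on \<Omega>. ?G x \<bullet> (A x *v U1 x)) -
      ((LINT x|lebesgue_on \<Omega>. (?G x - g x) \<bullet> (A x *v U2 x)) + (LINT x|lebesgue_on \<Omega>. g x \<bullet> (A x *v U2 x)))"
    by (subst Bochner_Integration.integral_diff, intro int L2, intro Bochner_Integration.integrable_add int L2 L2_diff)
       (subst Bochner_Integration.integral_add, intro int L2 L2_diff, intro int L2, simp)
  also have "\<dots> = F_form f \<Omega> ?e - F_form f \<Omega> (\<lambda>x. ?e x - w x)"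
    using orth eq1[unfolded a_form_eq[OF \<Omega> Am u(1) e]] eq2[unfolded a_form_eq[OF \<Omega> Am u(2) e1]] by simp
  also have "\<dots> = (LINT x|lebesgue_on \<Omega>. f x \<bullet> w x)"
    using L2_mult_integrable[OF f L2(1)] L2_mult_integrable[OF f w]
    by (simp add: F_form_def right_diff_distrib)
  also have "\<dots> \<le> L2_norm \<Omega> f * L2_norm \<Omega> w"
    using L2_Cauchy_Schwarz[OF f w] by linarith
  also have "\<dots> \<le> L2_norm \<Omega> f * (2 * H * L2_norm \<Omega> ?G)"
    by (intro mult_left_mono remainder_bound[OF \<Omega> P diam H e w aff H10] L2_norm_nonneg)
  finally have *: "L2_norm \<Omega> ?G * (m * L2_norm \<Omega> ?G) \<le> L2_norm \<Omega> ?G * (2 * H * L2_norm \<Omega> f)"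
    by (simp add: power2_eq_square mult_ac)
  show ?thesis
  proof (cases "L2_norm \<Omega> ?G = 0")
    case True
    then show ?thesis using H by (simp add: L2_norm_nonneg)
  next
    case False
    then have "0 < L2_norm \<Omega> ?G" using L2_norm_nonneg[of \<Omega> ?G] by simp
    with * show ?thesis by (simp only: mult_le_cancel_left_pos)
  qed
qed

theorem lemma6:
  fixes \<Omega> :: "(real^'d) set" and m M \<sigma> :: real
  assumes "open \<Omega>" "connected \<Omega>" "\<Omega> \<noteq> {}" "bounded \<Omega>"
    and "0 < m" "m \<le> M"
  shows "\<exists>C::real. \<forall>A \<T> \<phi> \<phi>\<epsilon> f uG uPG.
           elliptic_coeff \<Omega> m M A \<longrightarrow>
           conformal_simplicial_mesh \<Omega> \<T> \<longrightarrow>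
           shape_regular \<sigma> \<T> \<longrightarrow>
           P1_basis \<Omega> \<T> \<phi> \<longrightarrow>
           multiscale_basis A \<Omega> \<T> \<phi> \<phi>\<epsilon> \<longrightarrow>
           f \<in> L2 \<Omega> \<longrightarrow>
           discrete_solution A f \<Omega> (multiscale_space \<Omega> \<T> \<phi>\<epsilon>) (multiscale_space \<Omega> \<T> \<phi>\<epsilon>) uG \<longrightarrow>
           discrete_solution A f \<Omega> (multiscale_space \<Omega> \<T> \<phi>\<epsilon>) (P1_space \<Omega> \<T>) uPG \<longrightarrow>
           H1_norm \<Omega> (\<lambda>x. uG x - uPG x) \<le> C * mesh_size \<T> * L2_norm \<Omega> f"
proof (intro exI allI impI)
  fix A :: "real^'d \<Rightarrow> real^'d^'d" and \<T> and \<phi> \<phi>\<epsilon> :: "real^'d \<Rightarrow> real^'d \<Rightarrow> real" and f uG uPG :: "real^'d \<Rightarrow> real"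
  assume A: "elliptic_coeff \<Omega> m M A" and mesh: "conformal_simplicial_mesh \<Omega> \<T>"
    and \<phi>: "P1_basis \<Omega> \<T> \<phi>" and \<phi>\<epsilon>: "multiscale_basis A \<Omega> \<T> \<phi> \<phi>\<epsilon>" and f: "f \<in> L2 \<Omega>"
    and uG: "discrete_solution A f \<Omega> (multiscale_space \<Omega> \<T> \<phi>\<epsilon>) (multiscale_space \<Omega> \<T> \<phi>\<epsilon>) uG"
    and uPG: "discrete_solution A f \<Omega> (multiscale_space \<Omega> \<T> \<phi>\<epsilon>) (P1_space \<Omega> \<T>) uPG"
  let ?I = "interior_vertices \<Omega> \<T>" and ?R = "2 * diameter \<Omega>" and ?H = "mesh_size \<T>"
  note \<Omega> = assms(1,4)
  have part: "open_partition \<Omega> (interior ` \<T>)" by (rule mesh_open_partition[OF mesh \<Omega>(1)])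
  have H: "0 \<le> ?H" by (rule mesh_diameter(2)[OF mesh assms(3)])
  obtain cG cP where cG: "uG = (\<lambda>x. \<Sum>p\<in>?I. cG p * \<phi>\<epsilon> p x)" and cP: "uPG = (\<lambda>x. \<Sum>p\<in>?I. cP p * \<phi>\<epsilon> p x)"
    using uG uPG by (auto simp: discrete_solution_def multiscale_space_def)
  \<comment> \<open>The same coefficients applied to both bases give \<open>e\<close> and its \<open>P\<^sub>1\<close> counterpart; \<open>w\<close> is the difference.\<close>
  define c where "c p = cG p - cP p" for p
  define w where "w x = (\<Sum>p\<in>?I. c p * (\<phi>\<epsilon> p x - \<phi> p x))" for x
  have e: "(\<lambda>x. uG x - uPG x) = (\<lambda>x. \<Sum>p\<in>?I. c p * \<phi>\<epsilon> p x)"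
    by (simp add: cG cP c_def left_diff_distrib sum_subtractf)
  have e1: "(\<lambda>x. (uG x - uPG x) - w x) = (\<lambda>x. \<Sum>p\<in>?I. c p * \<phi> p x)"
    unfolding fun_cong[OF e] w_def by (simp add: right_diff_distrib sum_subtractf)
  have \<phi>\<epsilon>H10: "\<phi>\<epsilon> p \<in> H10 \<Omega>" if "p \<in> ?I" for p
    using \<phi>\<epsilon> that by (simp add: multiscale_basis_def)
  have uH10: "uG \<in> H10 \<Omega>" "uPG \<in> H10 \<Omega>" "(\<lambda>x. uG x - uPG x) \<in> H10 \<Omega>"
    unfolding e unfolding cG cP by (intro H10_sum[OF \<Omega>] \<phi>\<epsilon>H10; assumption)+
  have e1P1: "(\<lambda>x. (uG x - uPG x) - w x) \<in> P1_space \<Omega> \<T>"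
    unfolding e1 using \<phi> by (intro P1_space_sum) (simp add: P1_basis_def)
  obtain UG UP where U: "has_weak_gradient \<Omega> uG UG" "has_weak_gradient \<Omega> uPG UP"
    using H10_obtain_gradient uH10(1,2) by metis
  have wL2: "w \<in> L2 \<Omega>"
    using L2_diff[OF L2_diff[OF weak_gradient_L2(1)[OF U(1)] weak_gradient_L2(1)[OF U(2)]]
        P1_space_L2[OF \<Omega> e1P1]] by simp
  have wH10: "w \<in> H10 D" and wa: "a_form A D uPG w = 0" if "D \<in> interior ` \<T>" for D
  proof -
    from that obtain K where K: "K \<in> \<T>" "D = interior K" by blast
    have D: "open D" "D \<subseteq> \<Omega>" using part that by (auto simp: open_partition_def)
    then have b: "bounded D" using \<Omega>(2) bounded_subset by blast
    show w: "w \<in> H10 D"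
      unfolding w_def[abs_def] using \<phi>\<epsilon> K by (intro H10_sum D(1) b) (simp add: multiscale_basis_def)
    show "a_form A D uPG w = 0"
      unfolding cP
    proof (rule a_form_sum_eq_0[OF D(1) b elliptic_subset[OF A D(1) \<Omega>(1) D(2)] H10_imp_H1[OF w]])
      fix p assume p: "p \<in> ?I"
      obtain g where "has_weak_gradient \<Omega> (\<phi>\<epsilon> p) g"
        using \<phi>\<epsilon>H10[OF p] by (rule H10_obtain_gradient)
      then show "\<phi>\<epsilon> p \<in> H1 D"
        using has_weak_gradient_subset[OF D(1) \<Omega>(1) D(2)] by (auto simp: H1_def)
      show "a_form A D (\<phi>\<epsilon> p) w = 0"
        using \<phi>\<epsilon> p K w by (simp add: multiscale_basis_def)
    qed
  qed
  have wg: "has_weak_gradient \<Omega> (\<lambda>x. uG x - uPG x) (\<lambda>x. UG x - UP x)"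
    by (rule has_weak_gradient_diff[OF \<Omega> U])
  let ?G = "L2_norm \<Omega> (\<lambda>x. UG x - UP x)"
  have "m * ?G \<le> 2 * ?H * L2_norm \<Omega> f"
  proof (rule Galerkin_Petrov_Galerkin_gradient_bound[OF \<Omega> assms(5) A f part _ H U wL2])
    show "\<exists>a b. \<forall>x\<in>D. (uG x - uPG x) - w x = a \<bullet> x + b" if "D \<in> interior ` \<T>" for D
    proof -
      from that obtain K where K: "K \<in> \<T>" "D = interior K" by blast
      then obtain a b where "\<forall>x\<in>K. (uG x - uPG x) - w x = a \<bullet> x + b"
        using e1P1 unfolding P1_space_def by blast
      then show ?thesis using K(2) interior_subset by blast
    qed
    show "a_form A \<Omega> uG (\<lambda>x. uG x - uPG x) = F_form f \<Omega> (\<lambda>x. uG x - uPG x)"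
      using uG unfolding discrete_solution_def e by (auto simp: multiscale_space_def)
    show "a_form A \<Omega> uPG (\<lambda>x. (uG x - uPG x) - w x) = F_form f \<Omega> (\<lambda>x. (uG x - uPG x) - w x)"
      using uPG e1P1 unfolding discrete_solution_def by blast
  qed (auto intro: mesh_diameter(1)[OF mesh] wH10 wa)
  then have G: "?G \<le> 2 / m * ?H * L2_norm \<Omega> f"
    using assms(5) by (simp add: field_simps)
  have "H1_norm \<Omega> (\<lambda>x. uG x - uPG x) = sqrt ((L2_norm \<Omega> (\<lambda>x. uG x - uPG x))\<^sup>2 + ?G\<^sup>2)"
    by (rule H1_norm_eq[OF \<Omega> wg])
  also have "\<dots> \<le> sqrt ((?R * ?G)\<^sup>2 + ?G\<^sup>2)"
    by (intro real_sqrt_le_mono add_right_mono power_mono Poincare[OF \<Omega> uH10(3) wg] L2_norm_nonneg)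
  also have "(?R * ?G)\<^sup>2 + ?G\<^sup>2 = (?R\<^sup>2 + 1) * ?G\<^sup>2"
    by (simp add: power_mult_distrib distrib_right)
  also have "sqrt ((?R\<^sup>2 + 1) * ?G\<^sup>2) = sqrt (?R\<^sup>2 + 1) * ?G"
    by (simp add: real_sqrt_mult L2_norm_nonneg)
  also have "\<dots> \<le> sqrt (?R\<^sup>2 + 1) * (2 / m * ?H * L2_norm \<Omega> f)"
    by (intro mult_left_mono G) simp
  finally show "H1_norm \<Omega> (\<lambda>x. uG x - uPG x) \<le> (sqrt (?R\<^sup>2 + 1) * (2 / m)) * ?H * L2_norm \<Omega> f"
    by (simp add: mult_ac)
qed

end
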